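(* Let $\Omega \subset \mathbb{R}^n$ be compact, $\alpha>0$, and let $\mathcal{D} \in \mathbb{L}(\mathcal{M}(\Omega); C_0(\Omega))$ be defined by $\mathcal{D}\mu = \rho*\mu$, where $0 \not\equiv \rho \in C_0(\mathbb{R}^n)\cap L^2(\mathbb{R}^n)$ satisfies $\rho(-y)=\rho(y)$ for all $y$ and $\mathcal{F}[\rho]\ge 0$. Let $F: \mathcal{M}(\Omega)\to\mathbb{R}$ be convex, pre-differentiable, and $L$-smooth with respect to $\|\cdot\|_{\mathcal{D}}$ for some $L \ge 0$: $$F(\nu)-F(\mu)-\langle F'(\mu)|\nu-\mu\rangle \le \frac{L}{2}\|\nu-\mu\|_{\mathcal{D}}^2 \quad\text{for all } \nu,\mu\in\mathcal{M}(\Omega).$$ Let the step length $\tau>0$ satisfy $\tau L \le 1$, let $G(\mu) = \alpha\|\mu\|_{\mathcal{M}(\Omega)} + \delta_{\ge 0}(\mu)$, and let $\bar\mu\in\mathcal{M}(\Omega)$ satisfy $0 \in \partial[F+G](\bar\mu)$. Let $\kappa \in (0,1)$ and let $\{\mu^k\}_{k\ge1}$ be generated by the forward-backward method $\mu$FB (defined in the context) from some $\mu^0\in\mathcal{Z}(\Omega)$, with the tolerance sequence $\{\epsilon_{k+1}\}_{k\in\mathbb{N}}\subset(0,\infty)$ satisfying $$\lim_{N\to\infty}\frac1N\sum_{k=0}^{N-1}\epsilon_{k+1}=0,$$ and with the conditions defining $\mu^{k+1}$ amended by $$\bigl\langle\min\{\epsilon_{k+1},\,\tau[v^k+\alpha]+\mathcal{D}(\mu^{k+1}-\mu^k)\}\,\big|\,\mu^{k+1}-\mu^k\bigr\rangle\le\frac{\kappa\epsilon_{k+1}}{k}\quad\text{for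 } k\ge1,$$ where $v^k = F'(\mu^k)$ and the minimum is pointwise. Then $[F+G](\mu^N)\to[F+G](\bar\mu)$ as $N\to\infty$; more precisely, for all $N\ge1$, $$[F+G](\mu^N)\le[F+G](\bar\mu)+\frac{1}{N\tau}\Bigl((2\kappa+\|\bar\mu\|_{\mathcal{M}(\Omega)})\sum_{k=0}^{N-1}\epsilon_{k+1}+\frac12\|\mu^0-\bar\mu\|_{\mathcal{D}}^2\Bigr).$$
   Context: All functions and measures are real-valued; $\mathbb{N}=\{0,1,2,\dots\}$. $\mathcal{M}(\Omega)$ is the space of finite Radon measures with the Radon (total variation) norm. $C_0(\Omega)$ (equal to $C(\Omega)$ for compact $\Omega$) is its designated predual, with dual product $\langle\phi|\mu\rangle=\int_\Omega\phi\,d\mu$. $\mathcal{Z}(\Omega)$ is the set of discrete measures (finite real combinations of Dirac measures at points of $\Omega$). $[\rho*\mu](x)=\int_\Omega\rho(x-y)\,d\mu(y)$; $\mathcal{F}$ is the Fourier transform; $\|\mu\|_{\mathcal{D}}=\sqrt{\langle\mathcal{D}\mu|\mu\rangle}$. $\delta_{\ge0}(\mu)$ equals $0$ if $\mu\ge0$ and $\infty$ otherwise. $F$ is pre-differentiable if it is Fréchet differentiable with $F'(\mu)\in C_0(\Omega)$ (identified with its canonical image in $\mathcal{M}(\Omega)^*$) for all $\mu$. For convex $H:\mathcal{M}(\Omega)\to[-\infty,\infty]$, the pre-subdifferential is $\partial H(\mu)=\{\phi\in C_0(\Omega)\mid H(\nu)-H(\mu)\ge\langle\phi|\nu-\mu\rangle\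 \forall\nu\in\mathcal{M}(\Omega)\}$. Method $\mu$FB: given $\mu^0\in\mathcal{Z}(\Omega)$, $\tau>0$, $\kappa\in(0,1)$ and tolerances $\epsilon_{k+1}>0$, for each $k\in\mathbb{N}$ let $v^k:=F'(\mu^k)$ and let $\mu^{k+1}\in\mathcal{Z}(\Omega)$, $\mu^{k+1}\ge0$, be computed so as to satisfy $$\tau[v^k+\alpha]+\mathcal{D}(\mu^{k+1}-\mu^k)\ge-\epsilon_{k+1}\ \text{ on }\Omega,$$ $$\tau[v^k+\alpha]+\mathcal{D}(\mu^{k+1}-\mu^k)\le\epsilon_{k+1}\ \text{ on }\operatorname{supp}\mu^{k+1},$$ $$\langle\tau[v^k+\alpha]+\mathcal{D}(\mu^{k+1}-\mu^k)|\mu^{k+1}\rangle\le\kappa\epsilon_{k+1}.$$ *)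

theory Defs
  imports "HOL-Analysis.Analysis"
begin

section \<open>Finite signed Radon measures\<close>

text \<open>
  Finite signed Borel measures, represented as countably additive real-valued functions on the
  Borel sets (and \<open>0\<close> on all other sets, so that equality is equality on Borel sets).  On a
  Euclidean space, every finite Borel measure is Radon.
\<close>

typedef (overloaded) ('a::topological_space) signed_measure =
  "{f :: 'a set \<Rightarrow> real. (\<forall>A. A \<notin> sets borel \<longrightarrow> f A = 0) \<and>
     (\<forall>A :: nat \<Rightarrow> 'a set. range A \<subseteq> sets borel \<longrightarrow> disjoint_family A \<longrightarrow>
        (\<lambda>i. f (A i)) sums f (\<Union>i. A i))}"
  morphisms sm Abs_signed_measure
  by (rule exI[of _ "\<lambda>_. 0"]) simp

setup_lifting type_definition_signed_measure

lemma sm_outside: "A \<notin> sets borel \<Longrightarrow> sm \<mu> A = 0"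
  using sm[of \<mu>] by blast

lemma sm_sums:
  "range A \<subseteq> sets borel \<Longrightarrow> disjoint_family A \<Longrightarrow> (\<lambda>i::nat. sm \<mu> (A i)) sums sm \<mu> (\<Union>i. A i)"
  using sm[of \<mu>] by blast

lemma signed_measure_eqI: "(\<And>A. A \<in> sets borel \<Longrightarrow> sm \<mu> A = sm \<nu> A) \<Longrightarrow> \<mu> = \<nu>"
  by (metis sm_inject sm_outside ext)

instantiation signed_measure :: (topological_space) real_vector
begin

lift_definition zero_signed_measure :: "'a signed_measure" is "\<lambda>_. 0"
  by simp

lift_definition plus_signed_measure ::
  "'a signed_measure \<Rightarrow> 'a signed_measure \<Rightarrow> 'a signed_measure" is "\<lambda>f g A. f A + g A"
  by (auto intro: sums_add)

lift_definition uminus_signed_measure :: "'a signed_measure \<Rightarrow> 'a signed_measure"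
  is "\<lambda>f A. - f A"
  by (auto intro: sums_minus)

lift_definition minus_signed_measure ::
  "'a signed_measure \<Rightarrow> 'a signed_measure \<Rightarrow> 'a signed_measure" is "\<lambda>f g A. f A - g A"
  by (auto intro: sums_diff)

lift_definition scaleR_signed_measure :: "real \<Rightarrow> 'a signed_measure \<Rightarrow> 'a signed_measure"
  is "\<lambda>c f A. c * f A"
  by (auto intro: sums_mult)

instance
  by standard (transfer; auto simp: algebra_simps)+

end

instantiation signed_measure :: (topological_space) order
begin

lift_definition less_eq_signed_measure :: "'a signed_measure \<Rightarrow> 'a signed_measure \<Rightarrow> bool"
  is "\<lambda>f g. \<forall>A \<in> sets borel. f A \<le> g A" .

definition less_signed_measure :: "'a signed_measure \<Rightarrow> 'a signed_measure \<Rightarrow> bool"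
  where "\<mu> < \<nu> \<longleftrightarrow> \<mu> \<le> \<nu> \<and> \<not> \<nu> \<le> (\<mu> :: 'a signed_measure)"

instance
proof
  fix \<mu> \<nu> \<eta> :: "'a signed_measure"
  show "\<mu> < \<nu> \<longleftrightarrow> \<mu> \<le> \<nu> \<and> \<not> \<nu> \<le> \<mu>"
    by (simp add: less_signed_measure_def)
  show "\<mu> \<le> \<mu>"
    by (simp add: less_eq_signed_measure.rep_eq)
  show "\<mu> \<le> \<eta>" if "\<mu> \<le> \<nu>" "\<nu> \<le> \<eta>"
    using that unfolding less_eq_signed_measure.rep_eq by (meson order_trans)
  show "\<mu> = \<nu>" if "\<mu> \<le> \<nu>" "\<nu> \<le> \<mu>"
    using that unfolding less_eq_signed_measure.rep_eq
    by (intro signed_measure_eqI) (simp add: order_antisym)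
qed

end

lift_definition dirac :: "'a::topological_space \<Rightarrow> 'a signed_measure"
  is "\<lambda>x A. if A \<in> sets borel then indicator A x else 0"
proof -
  fix x :: 'a
  have "(\<lambda>i. indicator (A i) x :: real) sums indicator (\<Union>i. A i) x"
    if "disjoint_family A" for A :: "nat \<Rightarrow> 'a set"
  proof (cases "x \<in> (\<Union>i. A i)")
    case True
    then obtain j where j: "x \<in> A j"
      by auto
    have "indicator (A i) x = (if i = j then 1 else 0 :: real)" for i
      using that j by (auto simp: disjoint_family_on_def indicator_def)
    then show ?thesis
      using True sums_single[of j "\<lambda>_. 1 :: real"] by simp
  qed (auto simp: indicator_def)
  moreover have "A i \<in> sets borel" "(\<Union>i. A i) \<in> sets borel"
    if "range A \<subseteq> sets borel" for A :: "nat \<Rightarrow> 'a set" and i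
    using that by auto
  ultimately show "(\<forall>A. A \<notin> sets borel \<longrightarrow> (if A \<in> sets borel then indicator A x else 0 :: real) = 0) \<and>
     (\<forall>A :: nat \<Rightarrow> 'a set. range A \<subseteq> sets borel \<longrightarrow> disjoint_family A \<longrightarrow>
        (\<lambda>i. if A i \<in> sets borel then indicator (A i) x else 0 :: real) sums
        (if (\<Union>i. A i) \<in> sets borel then indicator (\<Union>i. A i) x else 0))"
    by auto
qed


subsection \<open>Jordan decomposition and total variation\<close>

definition pos_part :: "'a::topological_space signed_measure \<Rightarrow> 'a measure"
  where "pos_part \<mu> =
    measure_of UNIV (sets borel) (\<lambda>A. SUP B \<in> {B \<in> sets borel. B \<subseteq> A}. ennreal (sm \<mu> B))"

definition neg_part :: "'a::topological_space signed_measure \<Rightarrow> 'a measure"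
  where "neg_part \<mu> = pos_part (- \<mu>)"

lemma sm_empty [simp]: "sm \<mu> {} = 0"
proof -
  have "(\<lambda>i::nat. sm \<mu> {}) sums sm \<mu> {}"
    using sm_sums[of "\<lambda>_. {}" \<mu>] by (auto simp: disjoint_family_on_def)
  then show ?thesis
    using summable_const_iff sums_summable by blast
qed

lemma sm_Un:
  assumes "A \<in> sets borel" "B \<in> sets borel" "A \<inter> B = {}"
  shows "sm \<mu> (A \<union> B) = sm \<mu> A + sm \<mu> B"
proof -
  have "(\<lambda>i. sm \<mu> (binaryset A B i)) sums sm \<mu> (\<Union>i. binaryset A B i)"
    using assms by (intro sm_sums) (auto simp: range_binaryset_eq disjoint_family_on_def binaryset_def)
  then have "(\<lambda>i. sm \<mu> (binaryset A B i)) sums sm \<mu> (A \<union> B)"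
    by (simp add: UN_binaryset_eq)
  moreover have "(\<lambda>i. sm \<mu> (binaryset A B i)) sums (sm \<mu> A + sm \<mu> B)"
    by (rule binaryset_sums) simp
  ultimately show ?thesis
    by (rule sums_unique2)
qed

lemma sm_Diff:
  assumes "A \<in> sets borel" "B \<in> sets borel" "B \<subseteq> A"
  shows "sm \<mu> (A - B) = sm \<mu> A - sm \<mu> B"
proof -
  have "(A - B) \<union> B = A" "(A - B) \<inter> B = {}"
    using assms(3) by auto
  then show ?thesis
    using sm_Un[of "A - B" B \<mu>] assms by simp
qed

lemma sm_bounded:
  fixes \<mu> :: "'a::topological_space signed_measure"
  shows "\<exists>C. \<forall>B. \<bar>sm \<mu> B\<bar> \<le> C"
proof (rule ccontr)
  define bad where "bad E \<longleftrightarrow> E \<in> sets borel \<and> (\<forall>C. \<exists>B \<in> sets borel. B \<subseteq> E \<and> \<bar>sm \<mu> B\<bar> > C)"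
    for E
  assume "\<not> ?thesis"
  then have "\<exists>B. \<bar>sm \<mu> B\<bar> > max 0 C" for C
    by (meson not_le)
  then have "\<exists>B \<in> sets borel. \<bar>sm \<mu> B\<bar> > C" for C
    by (metis sm_outside abs_zero less_irrefl max_less_iff_conj)
  then have UNIV: "bad UNIV"
    unfolding bad_def by auto
  have step: "\<exists>E'. bad E' \<and> E' \<subseteq> E \<and> \<bar>sm \<mu> (E - E')\<bar> > 1" if E: "bad E" for E
  proof -
    obtain A where A: "A \<in> sets borel" "A \<subseteq> E" "\<bar>sm \<mu> A\<bar> > \<bar>sm \<mu> E\<bar> + 1"
      using E unfolding bad_def by blast
    have Eb: "E \<in> sets borel"
      using E by (simp add: bad_def)
    have EA: "sm \<mu> (E - A) = sm \<mu> E - sm \<mu> A"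
      using A Eb by (intro sm_Diff)
    have "bad A \<or> bad (E - A)"
    proof (rule ccontr)
      assume "\<not> ?thesis"
      then obtain C1 C2 where
        C1: "\<And>B. B \<in> sets borel \<Longrightarrow> B \<subseteq> A \<Longrightarrow> \<bar>sm \<mu> B\<bar> \<le> C1" and
        C2: "\<And>B. B \<in> sets borel \<Longrightarrow> B \<subseteq> E - A \<Longrightarrow> \<bar>sm \<mu> B\<bar> \<le> C2"
        unfolding bad_def using A Eb by (meson not_le sets.Diff)
      have "\<bar>sm \<mu> B\<bar> \<le> C1 + C2" if B: "B \<in> sets borel" "B \<subseteq> E" for B
      proof -
        have "sm \<mu> B = sm \<mu> (B \<inter> A) + sm \<mu> (B - A)"
          using sm_Un[of "B \<inter> A" "B - A" \<mu>] A B by (auto simp: Int_Diff_Un)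
        moreover have "\<bar>sm \<mu> (B \<inter> A)\<bar> \<le> C1" "\<bar>sm \<mu> (B - A)\<bar> \<le> C2"
          using A B by (auto intro!: C1 C2)
        ultimately show ?thesis
          by linarith
      qed
      with E show False
        unfolding bad_def by (meson not_le)
    qed
    then show ?thesis
    proof
      assume "bad A"
      then show ?thesis
        using A EA by (intro exI[of _ A]) auto
    next
      assume "bad (E - A)"
      moreover have "E - (E - A) = A"
        using A by auto
      ultimately show ?thesis
        using A by (intro exI[of _ "E - A"]) auto
    qed
  qed
  define F where "F = rec_nat UNIV (\<lambda>_ E. SOME E'. bad E' \<and> E' \<subseteq> E \<and> \<bar>sm \<mu> (E - E')\<bar> > 1)"
  have F: "bad (F n)" for n
    by (induction n) (use UNIV someI_ex[OF step] in \<open>auto simp: F_def\<close>)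
  have FS: "F (Suc n) \<subseteq> F n" "\<bar>sm \<mu> (F n - F (Suc n))\<bar> > 1" for n
    using someI_ex[OF step[OF F[of n]]] by (auto simp: F_def)
  have dec: "m \<le> n \<Longrightarrow> F n \<subseteq> F m" for m n
    using FS(1) by (rule lift_Suc_antimono_le)
  have "disjoint_family (\<lambda>n. F n - F (Suc n))"
    unfolding disjoint_family_on_def
  proof (intro ballI impI)
    fix m n :: nat assume "m \<noteq> n"
    then show "(F m - F (Suc m)) \<inter> (F n - F (Suc n)) = {}"
      using dec[of "Suc m" n] dec[of "Suc n" m] by (cases m n rule: linorder_cases) auto
  qed
  moreover have "range (\<lambda>n. F n - F (Suc n)) \<subseteq> sets borel"
    using F by (auto simp: bad_def)
  ultimately have "(\<lambda>n. sm \<mu> (F n - F (Suc n))) sums sm \<mu> (\<Union>n. F n - F (Suc n))"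
    by (rule sm_sums[rotated])
  then have "(\<lambda>n. sm \<mu> (F n - F (Suc n))) \<longlonglongrightarrow> 0"
    by (intro summable_LIMSEQ_zero sums_summable)
  then have "eventually (\<lambda>n. \<bar>sm \<mu> (F n - F (Suc n))\<bar> < 1) sequentially"
    by (auto dest!: tendstoD[of _ _ _ 1] simp: dist_real_def)
  then show False
    using FS(2) by (auto simp: eventually_sequentially dest: less_asym)
qed

lemma sets_pos_part [simp]: "sets (pos_part \<mu>) = sets borel"
  unfolding pos_part_def by (simp add: sets_measure_of_conv sets.sigma_sets_eq[of borel, simplified])

lemma emeasure_pos_part:
  fixes \<mu> :: "'a::topological_space signed_measure"
  assumes "A \<in> sets borel"
  shows "emeasure (pos_part \<mu>) A = (SUP B \<in> {B \<in> sets borel. B \<subseteq> A}. ennreal (sm \<mu> B))"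
proof (rule emeasure_measure_of[OF pos_part_def])
  let ?v = "\<lambda>A. SUP B \<in> {B \<in> sets borel. B \<subseteq> A}. ennreal (sm \<mu> B)"
  show "positive (sets (pos_part \<mu>)) ?v"
    by (auto simp: positive_def intro!: antisym SUP_least)
  show "countably_additive (sets (pos_part \<mu>)) ?v"
  proof (rule countably_additiveI)
    fix A :: "nat \<Rightarrow> 'a set"
    assume "range A \<subseteq> sets (pos_part \<mu>)" and dj: "disjoint_family A"
    then have A: "range A \<subseteq> sets borel"
      by simp
    show "(\<Sum>i. ?v (A i)) = ?v (\<Union>i. A i)"
    proof (rule antisym)
      have "(\<Sum>i<n. ?v (A i)) \<le> ?v (\<Union>i<n. A i)" for n
      proof (induction n)
        case (Suc n)
        have "?v (\<Union>i<n. A i) + ?v (A n) \<le> ?v (\<Union>i<Suc n. A i)"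
        proof -
          have *: "ennreal (sm \<mu> B) + ennreal (sm \<mu> B') \<le> ?v (\<Union>i<Suc n. A i)"
            if B: "B \<in> sets borel" "B \<subseteq> (\<Union>i<n. A i)" and B': "B' \<in> sets borel" "B' \<subseteq> A n" for B B'
          proof -
            have "A i \<inter> A n = {}" if "i < n" for i
              using dj that by (simp add: disjoint_family_on_def)
            then have "B \<inter> B' = {}"
              using B(2) B'(2) by blast
            then have U: "sm \<mu> (B \<union> B') = sm \<mu> B + sm \<mu> B'"
              using B B' by (intro sm_Un)
            have le: "ennreal (sm \<mu> D) \<le> ?v (\<Union>i<Suc n. A i)"
              if "D = B \<or> D = B' \<or> D = B \<union> B'" for D
            proof (rule SUP_upper)
              have "B \<subseteq> (\<Union>i<Suc n. A i)" "B' \<subseteq> (\<Union>i<Suc n. A i)"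
                using B(2) B'(2) by (auto simp: lessThan_Suc)
              then show "D \<in> {B \<in> sets borel. B \<subseteq> (\<Union>i<Suc n. A i)}"
                using that B(1) B'(1) by auto
            qed
            show ?thesis
            proof (cases "sm \<mu> B \<ge> 0 \<and> sm \<mu> B' \<ge> 0")
              case True
              then show ?thesis
                using le[of "B \<union> B'"] U by (simp add: ennreal_plus)
            next
              case False
              then show ?thesis
                using le[of B] le[of B'] by (auto simp: not_le ennreal_neg)
            qed
          qed
          have S: "{B \<in> sets borel. B \<subseteq> E} \<noteq> {}" for E :: "'a set"
            by blast
          have "?v (\<Union>i<n. A i) + ?v (A n) =
            (SUP B' \<in> {B \<in> sets borel. B \<subseteq> A n}.
              SUP B \<in> {B \<in> sets borel. B \<subseteq> (\<Union>i<n. A i)}. ennreal (sm \<mu> B) + ennreal (sm \<mu> B'))"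
            by (simp only: ennreal_SUP_add_left[OF S] ennreal_SUP_add_right[OF S])
          also have "\<dots> \<le> ?v (\<Union>i<Suc n. A i)"
            using * by (intro SUP_least) auto
          finally show ?thesis .
        qed
        moreover have "(\<Sum>i<Suc n. ?v (A i)) \<le> ?v (\<Union>i<n. A i) + ?v (A n)"
          unfolding sum.lessThan_Suc by (rule add_right_mono[OF Suc])
        ultimately show ?case
          by (rule order_trans[rotated])
      qed simp
      moreover have "?v (\<Union>i<n. A i) \<le> ?v (\<Union>i. A i)" for n
        by (rule SUP_subset_mono) auto
      ultimately have "(\<Sum>i<n. ?v (A i)) \<le> ?v (\<Union>i. A i)" for n
        by (rule order_trans)
      then show "(\<Sum>i. ?v (A i)) \<le> ?v (\<Union>i. A i)"
        by (rule suminf_le_const[OF summableI])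
      show "?v (\<Union>i. A i) \<le> (\<Sum>i. ?v (A i))"
      proof (rule SUP_least)
        fix B assume "B \<in> {B \<in> sets borel. B \<subseteq> (\<Union>i. A i)}"
        then have B: "B \<in> sets borel" "B \<subseteq> (\<Union>i. A i)"
          by auto
        have "(\<lambda>i. sm \<mu> (B \<inter> A i)) sums sm \<mu> (\<Union>i. B \<inter> A i)"
        proof (rule sm_sums)
          show "range (\<lambda>i. B \<inter> A i) \<subseteq> sets borel"
            using A B(1) by auto
          show "disjoint_family (\<lambda>i. B \<inter> A i)"
            using dj unfolding disjoint_family_on_def by blast
        qed
        moreover have "(\<Union>i. B \<inter> A i) = B"
          using B by auto
        ultimately have lim: "(\<lambda>n. \<Sum>i<n. sm \<mu> (B \<inter> A i)) \<longlonglongrightarrow> sm \<mu> B"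
          by (simp add: sums_def)
        have "ennreal (\<Sum>i<n. sm \<mu> (B \<inter> A i)) \<le> (\<Sum>i. ?v (A i))" for n
        proof -
          have "ennreal (\<Sum>i<n. sm \<mu> (B \<inter> A i)) \<le> ennreal (\<Sum>i<n. max 0 (sm \<mu> (B \<inter> A i)))"
            by (intro ennreal_leI sum_mono) auto
          also have "\<dots> = (\<Sum>i<n. ennreal (max 0 (sm \<mu> (B \<inter> A i))))"
            by (rule sum_ennreal[symmetric]) auto
          also have "\<dots> \<le> (\<Sum>i<n. ?v (A i))"
          proof (rule sum_mono)
            fix i
            have "ennreal (max 0 (sm \<mu> (B \<inter> A i))) = ennreal (sm \<mu> (B \<inter> A i))"
              by (simp add: max_def ennreal_neg)
            also have "\<dots> \<le> ?v (A i)"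
              using A B by (intro SUP_upper) auto
            finally show "ennreal (max 0 (sm \<mu> (B \<inter> A i))) \<le> ?v (A i)" .
          qed
          also have "\<dots> \<le> (\<Sum>i. ?v (A i))"
            by (rule sum_le_suminf) auto
          finally show ?thesis .
        qed
        then show "ennreal (sm \<mu> B) \<le> (\<Sum>i. ?v (A i))"
          by (intro LIMSEQ_le_const2[OF tendsto_ennrealI[OF lim]]) auto
      qed
    qed
  qed
qed (use assms in auto)

lemma finite_measure_pos_part: "finite_measure (pos_part \<mu>)"
proof
  obtain C where C: "\<And>B. \<bar>sm \<mu> B\<bar> \<le> C"
    using sm_bounded by blast
  have "emeasure (pos_part \<mu>) UNIV \<le> ennreal C"
    using C by (auto simp: emeasure_pos_part abs_le_iff intro!: SUP_least ennreal_leI)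
  then show "emeasure (pos_part \<mu>) (space (pos_part \<mu>)) \<noteq> \<infinity>"
    using sets_eq_imp_space_eq[OF sets_pos_part[of \<mu>]] by (auto simp: top_unique)
qed

lemma sm_le_pos_part:
  assumes "A \<in> sets borel" "B \<in> sets borel" "B \<subseteq> A"
  shows "sm \<mu> B \<le> measure (pos_part \<mu>) A"
proof -
  have "ennreal (sm \<mu> B) \<le> emeasure (pos_part \<mu>) A"
    using assms by (auto simp: emeasure_pos_part intro: SUP_upper)
  also have "\<dots> = ennreal (measure (pos_part \<mu>) A)"
    by (simp add: finite_measure.emeasure_eq_measure[OF finite_measure_pos_part])
  finally show ?thesis
    by (simp add: ennreal_le_iff)
qed

lemma pos_part_le:
  assumes "A \<in> sets borel" "\<And>B. B \<in> sets borel \<Longrightarrow> B \<subseteq> A \<Longrightarrow> sm \<mu> B \<le> c"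
  shows "measure (pos_part \<mu>) A \<le> c"
proof -
  have "0 \<le> c"
    using assms(2)[of "{}"] by simp
  moreover have "emeasure (pos_part \<mu>) A \<le> ennreal c"
    using assms by (auto simp: emeasure_pos_part intro!: SUP_least ennreal_leI)
  ultimately show ?thesis
    by (simp add: finite_measure.emeasure_eq_measure[OF finite_measure_pos_part] ennreal_le_iff)
qed

lemma sm_eq_Jordan:
  assumes A: "A \<in> sets borel"
  shows "sm \<mu> A = measure (pos_part \<mu>) A - measure (neg_part \<mu>) A"
proof (rule antisym)
  have "measure (pos_part (- \<mu>)) A \<le> measure (pos_part \<mu>) A - sm \<mu> A"
  proof (rule pos_part_le[OF A])
    fix B assume B: "B \<in> sets borel" "B \<subseteq> A"
    then show "sm (- \<mu>) B \<le> measure (pos_part \<mu>) A - sm \<mu> A"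
      using sm_le_pos_part[OF A, of "A - B" \<mu>] sm_Diff[OF A B, of \<mu>] A
      by (simp add: uminus_signed_measure.rep_eq)
  qed
  then show "sm \<mu> A \<le> measure (pos_part \<mu>) A - measure (neg_part \<mu>) A"
    by (simp add: neg_part_def)
  have "measure (pos_part \<mu>) A \<le> measure (pos_part (- \<mu>)) A + sm \<mu> A"
  proof (rule pos_part_le[OF A])
    fix B assume B: "B \<in> sets borel" "B \<subseteq> A"
    then show "sm \<mu> B \<le> measure (pos_part (- \<mu>)) A + sm \<mu> A"
      using sm_le_pos_part[OF A, of "A - B" "- \<mu>"] sm_Diff[OF A B, of \<mu>] A
      by (simp add: uminus_signed_measure.rep_eq)
  qed
  then show "measure (pos_part \<mu>) A - measure (neg_part \<mu>) A \<le> sm \<mu> A"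
    by (simp add: neg_part_def)
qed

lemma pos_part_add_le:
  "measure (pos_part (\<mu> + \<nu>)) UNIV \<le> measure (pos_part \<mu>) UNIV + measure (pos_part \<nu>) UNIV"
  by (rule pos_part_le) (auto simp: plus_signed_measure.rep_eq intro!: add_mono sm_le_pos_part)

lemma pos_part_scaleR_le:
  fixes \<mu> :: "'a::topological_space signed_measure"
  assumes "0 \<le> c"
  shows "measure (pos_part (c *\<^sub>R \<mu>)) UNIV \<le> c * measure (pos_part \<mu>) UNIV"
proof (rule pos_part_le)
  fix B :: "'a set" assume "B \<in> sets borel"
  then show "sm (c *\<^sub>R \<mu>) B \<le> c * measure (pos_part \<mu>) UNIV"
    unfolding scaleR_signed_measure.rep_eq using assms by (intro mult_left_mono sm_le_pos_part) auto
qed simp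

lemma pos_part_scaleR:
  assumes "0 \<le> c"
  shows "measure (pos_part (c *\<^sub>R \<mu>)) UNIV = c * measure (pos_part \<mu>) UNIV"
proof (cases "c = 0")
  case True
  then show ?thesis
    using pos_part_scaleR_le[of 0 \<mu>] by (simp add: order_antisym)
next
  case False
  then have c: "c > 0"
    using assms by simp
  have "measure (pos_part (inverse c *\<^sub>R (c *\<^sub>R \<mu>))) UNIV
      \<le> inverse c * measure (pos_part (c *\<^sub>R \<mu>)) UNIV"
    using c by (intro pos_part_scaleR_le) simp
  then have "c * measure (pos_part \<mu>) UNIV \<le> measure (pos_part (c *\<^sub>R \<mu>)) UNIV"
    using c by (simp add: field_simps)
  with pos_part_scaleR_le[OF assms, of \<mu>] show ?thesis
    by simp
qed

instantiation signed_measure :: (topological_space) real_normed_vector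
begin

text \<open>The Radon (total variation) norm \<open>\<bar>\<mu>\<bar>(UNIV)\<close>, where \<open>\<bar>\<mu>\<bar> = \<mu>\<^sup>+ + \<mu>\<^sup>-\<close>.\<close>

definition norm_signed_measure :: "'a signed_measure \<Rightarrow> real"
  where "norm_signed_measure \<mu> = measure (pos_part \<mu>) UNIV + measure (neg_part \<mu>) UNIV"

definition dist_signed_measure :: "'a signed_measure \<Rightarrow> 'a signed_measure \<Rightarrow> real"
  where "dist_signed_measure \<mu> \<nu> = norm (\<mu> - \<nu>)"

definition sgn_signed_measure :: "'a signed_measure \<Rightarrow> 'a signed_measure"
  where "sgn_signed_measure \<mu> = inverse (norm \<mu>) *\<^sub>R \<mu>"

definition uniformity_signed_measure :: "('a signed_measure \<times> 'a signed_measure) filter"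
  where "uniformity_signed_measure = (INF e\<in>{0<..}. principal {(\<mu>, \<nu>). dist \<mu> \<nu> < e})"

definition open_signed_measure :: "'a signed_measure set \<Rightarrow> bool"
  where "open_signed_measure U \<longleftrightarrow>
    (\<forall>\<mu>\<in>U. \<forall>\<^sub>F (\<mu>', \<nu>) in uniformity. \<mu>' = \<mu> \<longrightarrow> \<nu> \<in> U)"

instance
proof
  fix \<mu> \<nu> :: "'a signed_measure" and a :: real
  show "norm \<mu> = 0 \<longleftrightarrow> \<mu> = 0"
  proof
    assume "norm \<mu> = 0"
    then have 0: "measure (pos_part \<mu>) UNIV = 0" "measure (pos_part (- \<mu>)) UNIV = 0"
      using measure_nonneg[of "pos_part \<mu>" UNIV] measure_nonneg[of "pos_part (- \<mu>)" UNIV]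
      unfolding norm_signed_measure_def neg_part_def by linarith+
    show "\<mu> = 0"
    proof (rule signed_measure_eqI)
      fix A :: "'a set" assume "A \<in> sets borel"
      then show "sm \<mu> A = sm 0 A"
        using sm_le_pos_part[of UNIV A \<mu>] sm_le_pos_part[of UNIV A "- \<mu>"] 0
        by (simp add: uminus_signed_measure.rep_eq zero_signed_measure.rep_eq)
    qed
  next
    assume "\<mu> = 0"
    then show "norm \<mu> = 0"
      using pos_part_scaleR[of 0 \<mu>] by (simp add: norm_signed_measure_def neg_part_def)
  qed
  show "norm (\<mu> + \<nu>) \<le> norm \<mu> + norm \<nu>"
    using pos_part_add_le[of \<mu> \<nu>] pos_part_add_le[of "- \<mu>" "- \<nu>"]
    by (simp add: norm_signed_measure_def neg_part_def)
  show "norm (a *\<^sub>R \<mu>) = \<bar>a\<bar> * norm \<mu>"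
  proof (cases "a \<ge> 0")
    case True
    then show ?thesis
      using pos_part_scaleR[of a \<mu>] pos_part_scaleR[of a "- \<mu>"]
      by (simp add: norm_signed_measure_def neg_part_def algebra_simps)
  next
    case False
    then show ?thesis
      using pos_part_scaleR[of "- a" \<mu>] pos_part_scaleR[of "- a" "- \<mu>"]
      by (simp add: norm_signed_measure_def neg_part_def algebra_simps)
  qed
qed (simp_all add: dist_signed_measure_def sgn_signed_measure_def uniformity_signed_measure_def
    open_signed_measure_def)

end


subsection \<open>Integration, support, and the space of measures on \<open>\<Omega>\<close>\<close>

text \<open>\<open>M(\<Omega>)\<close> is the subspace of the measures on the whole space that are concentrated on \<open>\<Omega>\<close>.\<close>

definition measures_on :: "'a::topological_space set \<Rightarrow> 'a signed_measure set"
  where "measures_on \<Omega> = {\<mu>. \<forall>A \<in> sets borel. A \<inter> \<Omega> = {} \<longrightarrow> sm \<mu> A = 0}"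

definition discrete_measures :: "'a::topological_space set \<Rightarrow> 'a signed_measure set"
  where "discrete_measures \<Omega> = span (dirac ` \<Omega>)"

definition pairing :: "'a::topological_space set \<Rightarrow> ('a \<Rightarrow> real) \<Rightarrow> 'a signed_measure \<Rightarrow> real"
  where "pairing \<Omega> \<phi> \<mu> = (LINT x:\<Omega>|pos_part \<mu>. \<phi> x) - (LINT x:\<Omega>|neg_part \<mu>. \<phi> x)"

definition supp :: "'a::topological_space signed_measure \<Rightarrow> 'a set"
  where "supp \<mu> =
    {x. \<forall>U. open U \<longrightarrow> x \<in> U \<longrightarrow> 0 < measure (pos_part \<mu>) U + measure (neg_part \<mu>) U}"


section \<open>The convolution operator and the induced seminorm\<close>

definition conv_op ::
  "'a::euclidean_space set \<Rightarrow> ('a \<Rightarrow> real) \<Rightarrow> 'a signed_measure \<Rightarrow> 'a \<Rightarrow> real"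
  where "conv_op \<Omega> \<rho> \<mu> x = pairing \<Omega> (\<lambda>y. \<rho> (x - y)) \<mu>"

definition norm_conv :: "'a::euclidean_space set \<Rightarrow> ('a \<Rightarrow> real) \<Rightarrow> 'a signed_measure \<Rightarrow> real"
  where "norm_conv \<Omega> \<rho> \<mu> = sqrt (pairing \<Omega> (conv_op \<Omega> \<rho> \<mu>) \<mu>)"

text \<open>
  The Fourier transform of \<open>\<rho> \<in> L\<^sup>2\<close>, which need not be integrable, is the \<open>L\<^sup>2\<close>-limit \<open>g\<close> as
  \<open>R \<rightarrow> \<infinity>\<close> of the Fourier integrals over the balls of radius \<open>R\<close> (Plancherel).  It is
  determined up to null sets, hence the formulation as a relation.
\<close>

definition L2_fourier_transform :: "('a::euclidean_space \<Rightarrow> real) \<Rightarrow> ('a \<Rightarrow> complex) \<Rightarrow> bool"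
  where "L2_fourier_transform \<rho> g \<longleftrightarrow>
    g \<in> borel_measurable lborel \<and>
    integrable lborel (\<lambda>\<xi>. (cmod (g \<xi>))\<^sup>2) \<and>
    ((\<lambda>R. \<integral>\<^sup>+\<xi>. ennreal ((cmod (g \<xi> -
        (LINT x:cball 0 R|lborel. complex_of_real (\<rho> x) * cis (- 2 * pi * (x \<bullet> \<xi>)))))\<^sup>2) \<partial>lborel)
      \<longlongrightarrow> 0) at_top"


section \<open>Convex analysis on \<open>M(\<Omega>)\<close>\<close>

text \<open>
  The subdifferential with elements in the predual.  For compact \<open>\<Omega>\<close> the predual \<open>C\<^sub>0(\<Omega>)\<close> is
  \<open>C(\<Omega>)\<close>; its elements are represented by functions on the whole space whose values outside
  \<open>\<Omega>\<close> are irrelevant.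
\<close>

definition pre_subdiff ::
  "'a::euclidean_space set \<Rightarrow> ('a signed_measure \<Rightarrow> ereal) \<Rightarrow> 'a signed_measure \<Rightarrow> ('a \<Rightarrow> real) set"
  where "pre_subdiff \<Omega> H \<mu> =
    {\<phi>. continuous_on \<Omega> \<phi> \<and>
      (\<forall>\<nu> \<in> measures_on \<Omega>. H \<nu> - H \<mu> \<ge> ereal (pairing \<Omega> \<phi> (\<nu> - \<mu>)))}"

definition is_pre_derivative ::
  "'a::euclidean_space set \<Rightarrow> ('a signed_measure \<Rightarrow> real) \<Rightarrow> ('a signed_measure \<Rightarrow> 'a \<Rightarrow> real) \<Rightarrow> bool"
  where "is_pre_derivative \<Omega> F F' \<longleftrightarrow>
    (\<forall>\<mu> \<in> measures_on \<Omega>. continuous_on \<Omega> (F' \<mu>) \<and>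
      (F has_derivative pairing \<Omega> (F' \<mu>)) (at \<mu> within measures_on \<Omega>))"

definition delta_nonneg :: "'a::topological_space signed_measure \<Rightarrow> ereal"
  where "delta_nonneg \<mu> = (if 0 \<le> \<mu> then 0 else \<infinity>)"

definition regulariser :: "real \<Rightarrow> 'a::topological_space signed_measure \<Rightarrow> ereal"
  where "regulariser \<alpha> \<mu> = ereal (\<alpha> * norm \<mu>) + delta_nonneg \<mu>"


definition objective ::
  "('a::topological_space signed_measure \<Rightarrow> real) \<Rightarrow> real \<Rightarrow> 'a signed_measure \<Rightarrow> ereal"
  where "objective F \<alpha> \<mu> = ereal (F \<mu>) + regulariser \<alpha> \<mu>"


section \<open>The forward-backward method\<close>

definition FB_residual ::
  "'a::euclidean_space set \<Rightarrow> ('a \<Rightarrow> real) \<Rightarrow> ('a signed_measure \<Rightarrow> 'a \<Rightarrow> real) \<Rightarrow> real \<Rightarrow> real \<Rightarrow>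
    (nat \<Rightarrow> 'a signed_measure) \<Rightarrow> nat \<Rightarrow> 'a \<Rightarrow> real"
  where "FB_residual \<Omega> \<rho> F' \<alpha> \<tau> \<mu> k x =
    \<tau> * (F' (\<mu> k) x + \<alpha>) + conv_op \<Omega> \<rho> (\<mu> (Suc k) - \<mu> k) x"

definition mu_FB ::
  "'a::euclidean_space set \<Rightarrow> ('a \<Rightarrow> real) \<Rightarrow> ('a signed_measure \<Rightarrow> 'a \<Rightarrow> real) \<Rightarrow> real \<Rightarrow> real \<Rightarrow> real \<Rightarrow>
    (nat \<Rightarrow> real) \<Rightarrow> (nat \<Rightarrow> 'a signed_measure) \<Rightarrow> bool"
  where "mu_FB \<Omega> \<rho> F' \<alpha> \<tau> \<kappa> \<epsilon> \<mu> \<longleftrightarrow>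
    \<mu> 0 \<in> discrete_measures \<Omega> \<and>
    (\<forall>k. \<mu> (Suc k) \<in> discrete_measures \<Omega> \<and> 0 \<le> \<mu> (Suc k) \<and>
      (\<forall>x \<in> \<Omega>. FB_residual \<Omega> \<rho> F' \<alpha> \<tau> \<mu> k x \<ge> - \<epsilon> (Suc k)) \<and>
      (\<forall>x \<in> supp (\<mu> (Suc k)). FB_residual \<Omega> \<rho> F' \<alpha> \<tau> \<mu> k x \<le> \<epsilon> (Suc k)) \<and>
      pairing \<Omega> (FB_residual \<Omega> \<rho> F' \<alpha> \<tau> \<mu> k) (\<mu> (Suc k)) \<le> \<kappa> * \<epsilon> (Suc k))"

end

theory Submission
  imports Defs "HOL-Probability.Characteristic_Functions"
begin

text \<open>
  Convexity of \<open>F\<close>, its \<open>L\<close>-smoothness with \<open>\<tau> L \<le> 1\<close>, and the approximate optimality conditions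
  of the method bound \<open>\<tau> ([F+G](\<mu>\<^sup>k\<^sup>+\<^sup>1) - [F+G](\<mu>bar))\<close> by \<open>(\<kappa> + \<parallel>\<mu>bar\<parallel>) \<epsilon>\<close> plus a telescoping difference of
  the squared distances \<open>\<parallel>\<mu>\<^sup>k - \<mu>bar\<parallel>\<^sup>2 / 2\<close> in the \<open>\<D>\<close>-seminorm.  The amended condition makes the values of
  \<open>F+G\<close> decrease up to an error \<open>\<kappa> \<epsilon> / k\<close> per step, small enough for \<open>k\<close> times the excess value to
  telescope as well.

  The analytic part is \<open>\<langle>\<D>\<mu>|\<mu>\<rangle> \<ge> 0\<close> for every measure \<open>\<mu>\<close>.  Convolving \<open>\<rho>\<close> with a Gaussian gives
  \<open>a \<mapsto> \<integral> w(\<xi>) cos(2\<pi> a\<bullet>\<xi>) d\<xi>\<close>, where \<open>w\<close> is a Gaussian times the Fourier transform of \<open>\<rho>\<close>; as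
  \<open>w \<ge> 0\<close>, its quadratic form is the integral of \<open>w\<close> times a sum of two squares.  Then the width of the
  Gaussian tends to \<open>0\<close>.
\<close>


section \<open>Integration against signed measures\<close>

text \<open>Both Jordan parts are finite measures, so every function of this class is integrable
  against both of them and linearity of integrals becomes available without further side
  conditions.\<close>

definition bdd_borel :: "('a::topological_space \<Rightarrow> real) \<Rightarrow> bool"
  where "bdd_borel f \<longleftrightarrow> f \<in> borel_measurable borel \<and> (\<exists>C. \<forall>x. \<bar>f x\<bar> \<le> C)"

text \<open>The integral over the whole space. \<open>pairing\<close> reduces to it by multiplying
  the integrand with the indicator of \<open>\<Omega>\<close>, which keeps set integrals out of the
  calculus below.\<close>

definition sint :: "'a::topological_space signed_measure \<Rightarrow> ('a \<Rightarrow> real) \<Rightarrow> real"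
  where "sint \<mu> f = (LINT x|pos_part \<mu>. f x) - (LINT x|neg_part \<mu>. f x)"

lemma sets_neg_part [simp]: "sets (neg_part \<mu>) = sets borel"
  by (simp add: neg_part_def)

lemma space_pos_part [simp]: "space (pos_part \<mu>) = UNIV"
  using sets_eq_imp_space_eq[OF sets_pos_part[of \<mu>]] by simp

lemma space_neg_part [simp]: "space (neg_part \<mu>) = UNIV"
  by (simp add: neg_part_def)

lemma measurable_pos_part [simp]: "measurable (pos_part \<mu>) N = measurable borel N"
  by (rule measurable_cong_sets) simp_all

lemma measurable_neg_part [simp]: "measurable (neg_part \<mu>) N = measurable borel N"
  by (rule measurable_cong_sets) simp_all

lemma finite_measure_neg_part: "finite_measure (neg_part \<mu>)"
  by (simp add: neg_part_def finite_measure_pos_part)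

lemma pairing_eq_sint: "pairing \<Omega> \<phi> \<mu> = sint \<mu> (\<lambda>x. indicator \<Omega> x * \<phi> x)"
  by (simp add: pairing_def sint_def set_lebesgue_integral_def)

lemma bdd_borelI: "f \<in> borel_measurable borel \<Longrightarrow> (\<And>x. \<bar>f x\<bar> \<le> C) \<Longrightarrow> bdd_borel f"
  by (auto simp: bdd_borel_def)

lemma bdd_borel_measurable: "bdd_borel f \<Longrightarrow> f \<in> borel_measurable borel"
  by (simp add: bdd_borel_def)

lemma bdd_borel_bound: assumes "bdd_borel f" obtains C where "0 \<le> C" "\<And>x. \<bar>f x\<bar> \<le> C"
proof -
  obtain C where "\<And>x. \<bar>f x\<bar> \<le> C" using assms by (auto simp: bdd_borel_def)
  moreover from this[of undefined] have "0 \<le> C" by linarith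
  ultimately show ?thesis using that by blast
qed

lemma bdd_borel_const: "bdd_borel (\<lambda>x. c)"
  by (rule bdd_borelI[where C="\<bar>c\<bar>"]) auto

lemma bdd_borel_add: assumes "bdd_borel f" "bdd_borel g" shows "bdd_borel (\<lambda>x. f x + g x)"
proof -
  obtain C D where "\<And>x. \<bar>f x\<bar> \<le> C" "\<And>x. \<bar>g x\<bar> \<le> D"
    using assms bdd_borel_bound by metis
  then have "\<And>x. \<bar>f x + g x\<bar> \<le> C + D" by (meson abs_triangle_ineq add_mono order_trans)
  then show ?thesis using assms by (intro bdd_borelI[where C="C+D"] borel_measurable_add) (auto simp: bdd_borel_measurable)
qed

lemma bdd_borel_mult: assumes "bdd_borel f" "bdd_borel g" shows "bdd_borel (\<lambda>x. f x * g x)"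
proof -
  obtain C D where "0 \<le> C" "\<And>x. \<bar>f x\<bar> \<le> C" "\<And>x. \<bar>g x\<bar> \<le> D"
    using assms bdd_borel_bound by metis
  then have "\<And>x. \<bar>f x * g x\<bar> \<le> C * D" by (simp add: abs_mult mult_mono)
  then show ?thesis using assms by (intro bdd_borelI[where C="C*D"] borel_measurable_times) (auto simp: bdd_borel_measurable)
qed

lemma bdd_borel_diff: assumes "bdd_borel f" "bdd_borel g" shows "bdd_borel (\<lambda>x. f x - g x)"
  using bdd_borel_add[OF assms(1) bdd_borel_mult[OF bdd_borel_const[of "-1"] assms(2)]] by simp

lemma integrable_bdd_borel:
  assumes "bdd_borel f" "finite_measure M" "sets M = sets borel"
  shows "integrable M f"
proof -
  obtain C where C: "\<And>x. \<bar>f x\<bar> \<le> C" using assms bdd_borel_bound by metis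
  have "f \<in> borel_measurable M"
    using assms(1,3) by (simp add: bdd_borel_def cong: measurable_cong_sets)
  then show ?thesis
    using C by (intro finite_measure.integrable_const_bound[OF assms(2), where B=C]) auto
qed

lemma integrable_pos_part: "bdd_borel f \<Longrightarrow> integrable (pos_part \<mu>) f"
  by (rule integrable_bdd_borel[OF _ finite_measure_pos_part]) simp_all

lemma integrable_neg_part: "bdd_borel f \<Longrightarrow> integrable (neg_part \<mu>) f"
  by (rule integrable_bdd_borel[OF _ finite_measure_neg_part]) simp_all

section \<open>Linearity and limits of the signed integral\<close>

lemma sint_add_fun:
  "bdd_borel f \<Longrightarrow> bdd_borel g \<Longrightarrow> sint \<mu> (\<lambda>x. f x + g x) = sint \<mu> f + sint \<mu> g"
  by (simp add: sint_def integrable_pos_part integrable_neg_part)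

lemma sint_diff_fun:
  "bdd_borel f \<Longrightarrow> bdd_borel g \<Longrightarrow> sint \<mu> (\<lambda>x. f x - g x) = sint \<mu> f - sint \<mu> g"
  by (simp add: sint_def integrable_pos_part integrable_neg_part)

lemma sint_cmult: "sint \<mu> (\<lambda>x. c * f x) = c * sint \<mu> f"
  by (simp add: sint_def right_diff_distrib)

lemma sint_multc: "sint \<mu> (\<lambda>x. f x * c) = sint \<mu> f * c"
  by (simp add: sint_def left_diff_distrib)

lemma sint_sum:
  "(\<And>i. i \<in> I \<Longrightarrow> bdd_borel (f i)) \<Longrightarrow> sint \<mu> (\<lambda>x. \<Sum>i\<in>I. f i x) = (\<Sum>i\<in>I. sint \<mu> (f i))"
  by (simp add: sint_def integrable_pos_part integrable_neg_part sum_subtractf)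

lemma bdd_borel_indicator: "A \<in> sets borel \<Longrightarrow> bdd_borel (indicator A)"
  by (rule bdd_borelI[where C=1]) (auto simp: indicator_def)

lemma sint_indicator: "A \<in> sets borel \<Longrightarrow> sint \<mu> (indicator A) = sm \<mu> A"
  by (simp add: sint_def sm_eq_Jordan)

text \<open>Expresses the integral through \<open>sm\<close> alone. The Jordan parts of a sum of
  measures are in general not the sums of the Jordan parts, so additivity in the measure has to be
  read off from \<open>sm\<close>.\<close>

lemma sint_simple:
  assumes "simple_function borel s"
  shows "sint \<mu> s = (\<Sum>y\<in>range s. y * sm \<mu> (s -` {y}))"
proof -
  have fin: "finite (range s)"
    using assms by (auto simp: simple_function_def)
  have m: "s -` {y} \<in> sets borel" for y
    using measurable_sets[OF borel_measurable_simple_function[OF assms], of "{y}"] by simp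
  have "s = (\<lambda>x. \<Sum>y\<in>range s. y * indicator (s -` {y}) x)"
    using fin by (auto simp: indicator_def sum.delta' if_distrib cong: if_cong)
  then have "sint \<mu> s = sint \<mu> (\<lambda>x. \<Sum>y\<in>range s. y * indicator (s -` {y}) x)" by simp
  also have "\<dots> = (\<Sum>y\<in>range s. sint \<mu> (\<lambda>x. y * indicator (s -` {y}) x))"
    using m by (intro sint_sum bdd_borel_mult bdd_borel_const bdd_borel_indicator)
  finally show ?thesis
    using m by (simp add: sint_cmult sint_indicator)
qed

lemma sint_tendsto:
  assumes "\<And>n. f n \<in> borel_measurable borel" "g \<in> borel_measurable borel"
    and "\<And>x. (\<lambda>n. f n x) \<longlonglongrightarrow> g x" and "\<And>n x. \<bar>f n x\<bar> \<le> C"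
  shows "(\<lambda>n. sint \<mu> (f n)) \<longlonglongrightarrow> sint \<mu> g"
  unfolding sint_def using assms
  by (intro tendsto_diff integral_dominated_convergence[where w="\<lambda>_. C"])
     (auto intro!: integrable_pos_part integrable_neg_part bdd_borel_const)

lemma simple_approx_bdd_borel:
  assumes "bdd_borel f"
  obtains s C where "\<And>n::nat. simple_function borel (s n)" "\<And>x. (\<lambda>n. s n x) \<longlonglongrightarrow> f x"
    "\<And>n x. \<bar>s n x\<bar> \<le> C"
proof -
  obtain C where C: "\<And>x. \<bar>f x\<bar> \<le> C" using assms bdd_borel_bound by metis
  \<comment> \<open>The base point \<open>0\<close> turns the growth bound into
    \<open>\<bar>s n x\<bar> \<le> 2 * \<bar>f x\<bar>\<close>, hence into a bound uniform in
    \<open>n\<close> and \<open>x\<close>.\<close>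
  obtain s where s: "\<And>i::nat. simple_function borel (s i)" "\<And>x. (\<lambda>i. s i x) \<longlonglongrightarrow> f x"
     "\<And>i x. dist (s i x) 0 \<le> 2 * dist (f x) 0"
    using borel_measurable_implies_sequence_metric[OF bdd_borel_measurable[OF assms], of 0] by auto
  have "\<bar>s n x\<bar> \<le> 2 * C" for n x
    using s(3)[of n x] C[of x] by simp
  then show ?thesis using s that by blast
qed

text \<open>For simple functions the integral is a finite combination of values of
  \<open>sm\<close>, which add; uniformly bounded simple approximation and dominated convergence
  carry this over to \<open>f\<close>.\<close>

lemma sint_add:
  assumes f: "bdd_borel f"
  shows "sint (\<mu> + \<nu>) f = sint \<mu> f + sint \<nu> f"
proof -
  obtain s C where s: "\<And>n::nat. simple_function borel (s n)" "\<And>x. (\<lambda>n. s n x) \<longlonglongrightarrow> f x"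
    "\<And>n x. \<bar>s n x\<bar> \<le> C" using simple_approx_bdd_borel[OF f] by blast
  have lim: "(\<lambda>n. sint \<eta> (s n)) \<longlonglongrightarrow> sint \<eta> f" for \<eta>
    using s f by (intro sint_tendsto[where C=C]) (auto intro: borel_measurable_simple_function bdd_borel_measurable)
  have "sint (\<mu> + \<nu>) (s n) = sint \<mu> (s n) + sint \<nu> (s n)" for n
    by (simp add: sint_simple[OF s(1)] plus_signed_measure.rep_eq distrib_left sum.distrib)
  then show ?thesis
    using LIMSEQ_unique[OF lim[of "\<mu> + \<nu>"]] tendsto_add[OF lim[of \<mu>] lim[of \<nu>]] by simp
qed

lemma sint_diff: "bdd_borel f \<Longrightarrow> sint (\<mu> - \<nu>) f = sint \<mu> f - sint \<nu> f"
  using sint_add[of f "\<mu> - \<nu>" \<nu>] by simp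

section \<open>Nonnegative measures, their norm and their support\<close>

lemma nonneg_sm: "0 \<le> \<mu> \<Longrightarrow> 0 \<le> sm \<mu> A"
  by (cases "A \<in> sets borel") (auto simp: less_eq_signed_measure.rep_eq zero_signed_measure.rep_eq sm_outside)

lemma neg_part_nonneg:
  assumes "0 \<le> \<mu>" "A \<in> sets borel"
  shows "emeasure (neg_part \<mu>) A = 0"
proof -
  have "measure (pos_part (-\<mu>)) A \<le> 0"
    using assms by (intro pos_part_le) (auto simp: uminus_signed_measure.rep_eq nonneg_sm)
  then show ?thesis
    unfolding neg_part_def finite_measure.emeasure_eq_measure[OF finite_measure_pos_part]
    by (simp add: ennreal_neg)
qed

lemma sint_nonneg_eq:
  assumes "0 \<le> \<mu>" shows "sint \<mu> f = (LINT x|pos_part \<mu>. f x)"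
proof -
  \<comment> \<open>The whole space is a null set of \<open>neg_part \<mu>\<close>, so the property
    holds almost everywhere whatever \<open>f\<close> is.\<close>
  have "AE x in neg_part \<mu>. f x = 0"
    using neg_part_nonneg[OF assms, of UNIV]
    by (intro AE_I[where N=UNIV]) (auto)
  then have "(LINT x|neg_part \<mu>. f x) = 0" by (rule integral_eq_zero_AE)
  then show ?thesis by (simp add: sint_def)
qed

lemma norm_nonneg_eq:
  assumes "0 \<le> \<mu>" shows "norm \<mu> = sm \<mu> UNIV"
  using neg_part_nonneg[OF assms, of UNIV]
  by (simp add: norm_signed_measure_def sm_eq_Jordan measure_def)

lemma sint_mono:
  assumes "0 \<le> \<mu>" "bdd_borel f" "bdd_borel g" "\<And>x. f x \<le> g x"
  shows "sint \<mu> f \<le> sint \<mu> g"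
  unfolding sint_nonneg_eq[OF assms(1)] using assms
  by (intro integral_mono integrable_pos_part) auto

lemma subspace_measures_on: "subspace (measures_on \<Omega>)"
  by (auto simp: subspace_def measures_on_def zero_signed_measure.rep_eq
     plus_signed_measure.rep_eq scaleR_signed_measure.rep_eq)

lemma discrete_subset_measures_on: "discrete_measures \<Omega> \<subseteq> measures_on \<Omega>"
  unfolding discrete_measures_def
  by (rule span_minimal[OF _ subspace_measures_on])
     (auto simp: measures_on_def dirac.rep_eq indicator_def)

lemma sm_UNIV_measures_on:
  assumes "\<mu> \<in> measures_on \<Omega>" "\<Omega> \<in> sets borel"
  shows "sm \<mu> UNIV = sm \<mu> \<Omega>"
proof -
  have "sm \<mu> (UNIV - \<Omega>) = 0" using assms by (auto simp: measures_on_def)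
  then show ?thesis using sm_Diff[of UNIV \<Omega> \<mu>] assms by simp
qed

text \<open>On the nonnegative cone the norm is linear in the measure, which lets
  \<open>\<alpha> * norm\<close> be absorbed into the pairings of the method. Concentration on
  \<open>\<Omega>\<close> ensures that the integral over \<open>\<Omega>\<close> sees the full
  mass.\<close>

lemma norm_eq_pairing:
  assumes "0 \<le> \<mu>" "\<mu> \<in> measures_on \<Omega>" "\<Omega> \<in> sets borel"
  shows "pairing \<Omega> (\<lambda>_. c) \<mu> = c * norm \<mu>"
  using assms sm_UNIV_measures_on[OF assms(2,3)]
  by (simp add: pairing_eq_sint sint_multc sint_indicator norm_nonneg_eq)

text \<open>A point outside the support has a null neighbourhood, hence a null basic open one. A
  countable basis provides only countably many of these, so their union is still null.\<close>

lemma AE_supp: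
  fixes \<mu> :: "'a::second_countable_topology signed_measure"
  shows "AE x in pos_part \<mu>. x \<in> supp \<mu>"
proof -
  obtain B :: "'a set set" where B: "countable B" "topological_basis B"
    using ex_countable_basis by blast
  define N where "N = {b \<in> B. emeasure (pos_part \<mu>) b = 0}"
  have "(\<Union>b\<in>N. b) \<in> null_sets (pos_part \<mu>)"
    using B by (intro null_sets_UN' countable_subset[OF _ B(1)])
      (auto simp: N_def null_sets_def topological_basis_open)
  moreover have "{x. x \<notin> supp \<mu>} \<subseteq> (\<Union>b\<in>N. b)"
  proof
    fix x assume "x \<in> {x. x \<notin> supp \<mu>}"
    then obtain U where U: "open U" "x \<in> U" "\<not> 0 < measure (pos_part \<mu>) U + measure (neg_part \<mu>) U"
      by (auto simp: supp_def)
    then obtain b where b: "b \<in> B" "x \<in> b" "b \<subseteq> U"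
      using topological_basisE[OF B(2)] by metis
    have "measure (pos_part \<mu>) U = 0"
      using U(3) measure_nonneg[of "pos_part \<mu>" U] measure_nonneg[of "neg_part \<mu>" U] by linarith
    then have "emeasure (pos_part \<mu>) U = 0"
      by (simp add: finite_measure.emeasure_eq_measure[OF finite_measure_pos_part])
    then have "emeasure (pos_part \<mu>) b = 0"
      using emeasure_mono[OF b(3), of "pos_part \<mu>"] U(1) by simp
    then show "x \<in> (\<Union>b\<in>N. b)" using b by (auto simp: N_def)
  qed
  ultimately show ?thesis by (intro AE_I'[of "\<Union>b\<in>N. b"]) auto
qed

text \<open>Serves to remove the excess of the residual over the tolerance, which vanishes on the
  support of the new iterate.\<close>

lemma sint_nonneg_zero_on_supp:
  fixes \<mu> :: "'a::second_countable_topology signed_measure"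
  assumes "0 \<le> \<mu>" "\<And>x. x \<in> supp \<mu> \<Longrightarrow> f x = 0"
  shows "sint \<mu> f = 0"
  unfolding sint_nonneg_eq[OF assms(1)]
  using AE_supp[of \<mu>] by (intro integral_eq_zero_AE) (auto elim!: eventually_mono simp: assms(2))

section \<open>Exchange of integrals\<close>

lemma Fubini_bounded:
  fixes h :: "'a::topological_space \<Rightarrow> 'b \<Rightarrow> real"
  assumes M: "finite_measure M" "sets M = sets borel" and N: "sigma_finite_measure N"
    and h: "case_prod h \<in> borel_measurable (borel \<Otimes>\<^sub>M N)"
    and w: "integrable N w" and le: "\<And>x y. y \<in> space N \<Longrightarrow> \<bar>h x y\<bar> \<le> w y"
  shows "(LINT x|M. LINT y|N. h x y) = (LINT y|N. LINT x|M. h x y)"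
    and "integrable N (\<lambda>y. LINT x|M. h x y)"
    and "bdd_borel (\<lambda>x. LINT y|N. h x y)"
proof -
  interpret M: finite_measure M by fact
  interpret N: sigma_finite_measure N by fact
  interpret pair_sigma_finite M N ..
  \<comment> \<open>\<open>M\<close> merely shares its sets with \<open>borel\<close>. Measurability
    of \<open>h\<close> is stated over \<open>borel\<close>, so that one hypothesis serves both
    Jordan parts, and is transferred to \<open>M\<close> here.\<close>
  have meas: "borel_measurable (M \<Otimes>\<^sub>M N) = borel_measurable (borel \<Otimes>\<^sub>M N)"
    by (rule measurable_cong_sets[OF sets_pair_measure_cong]) (simp_all add: M)
  have h' [measurable]: "case_prod h \<in> borel_measurable (M \<Otimes>\<^sub>M N)"
    by (simp only: meas h)
  note h[measurable]
  have sp: "space M = UNIV" using sets_eq_imp_space_eq[OF M(2)] by simp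
  have hx: "(\<lambda>y. h x y) \<in> borel_measurable N" for x
    using measurable_compose[OF measurable_Pair1' h', of x] sp by (simp)
  have i: "integrable N (\<lambda>y. h x y)" for x
    by (rule Bochner_Integration.integrable_bound[OF w hx]) (auto intro!: order_trans[OF le])
  have b: "\<bar>LINT y|N. h x y\<bar> \<le> (LINT y|N. w y)" for x
    by (rule order_trans[OF integral_abs_bound integral_mono]) (auto intro: i w le)
  have b2: "\<bar>LINT y|N. \<bar>h x y\<bar>\<bar> \<le> (LINT y|N. w y)" for x
    by (simp, rule integral_mono) (auto intro: i w le)
  \<comment> \<open>The bound \<open>w y\<close> is uniform in \<open>x\<close>, so the inner
    integrals of \<open>\<bar>h x y\<bar>\<close> are bounded, and a bounded function is integrable
    over the finite measure \<open>M\<close>.\<close>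
  have int: "integrable (M \<Otimes>\<^sub>M N) (case_prod h)"
  proof (rule Fubini_integrable[OF h'])
    show "integrable M (\<lambda>x. LINT y|N. norm (case_prod h (x, y)))"
      using b2 by (intro M.integrable_const_bound[where B="LINT y|N. w y"]) auto
  qed (simp add: i)
  show "(LINT x|M. LINT y|N. h x y) = (LINT y|N. LINT x|M. h x y)"
    by (rule Fubini_integral[symmetric, OF int])
  show "integrable N (\<lambda>y. LINT x|M. h x y)"
    by (rule integrable_snd[OF int])
  show "bdd_borel (\<lambda>x. LINT y|N. h x y)"
    using b by (intro bdd_borelI[where C="LINT y|N. w y"]) auto
qed

lemma sint_Fubini:
  fixes h :: "'a::topological_space \<Rightarrow> 'b \<Rightarrow> real"
  assumes N: "sigma_finite_measure N"
    and h: "case_prod h \<in> borel_measurable (borel \<Otimes>\<^sub>M N)"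
    and w: "integrable N w" and le: "\<And>x y. y \<in> space N \<Longrightarrow> \<bar>h x y\<bar> \<le> w y"
  shows "sint \<mu> (\<lambda>x. LINT y|N. h x y) = (LINT y|N. sint \<mu> (\<lambda>x. h x y))"
    and "integrable N (\<lambda>y. sint \<mu> (\<lambda>x. h x y))"
  using Fubini_bounded[OF finite_measure_pos_part[of \<mu>] sets_pos_part N h w le]
    Fubini_bounded[OF finite_measure_neg_part[of \<mu>] sets_neg_part N h w le]
  by (simp_all add: sint_def)

text \<open>The previous lemma, applied with each Jordan part of \<open>\<nu>\<close> as the inner
  measure and the constant \<open>C\<close> as the dominating function. The exchange yields symmetry
  of the convolution form, the second claim boundedness of \<open>conv_op\<close>.\<close>

lemma sint_swap:
  fixes h :: "'a::second_countable_topology \<Rightarrow> 'b::second_countable_topology \<Rightarrow> real"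
  assumes h: "case_prod h \<in> borel_measurable borel" and le: "\<And>x y. \<bar>h x y\<bar> \<le> C"
  shows "sint \<mu> (\<lambda>x. sint \<nu> (\<lambda>y. h x y)) = sint \<nu> (\<lambda>y. sint \<mu> (\<lambda>x. h x y))"
    and "bdd_borel (\<lambda>x. sint \<nu> (\<lambda>y. h x y))"
proof -
  have *: "case_prod h \<in> borel_measurable (borel \<Otimes>\<^sub>M N)" if "sets N = sets borel" for N :: "'b measure"
    using h measurable_cong_sets[OF sets_pair_measure_cong[OF refl that]] borel_prod[where 'a='a and 'b='b]
    by metis
  have p: "integrable (pos_part \<nu>) (\<lambda>_. C)" "integrable (neg_part \<nu>) (\<lambda>_. C)"
    by (auto intro!: integrable_pos_part integrable_neg_part bdd_borel_const)
  note fp = finite_measure.sigma_finite_measure[OF finite_measure_pos_part[of \<nu>]]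
  note fn = finite_measure.sigma_finite_measure[OF finite_measure_neg_part[of \<nu>]]
  note P = sint_Fubini[OF fp *[OF sets_pos_part] p(1) le]
  note N = sint_Fubini[OF fn *[OF sets_neg_part] p(2) le]
  \<comment> \<open>Boundedness of the inner integral concerns \<open>\<nu>\<close> alone;
    \<open>pos_part \<mu>\<close> stands for an arbitrary finite outer measure.\<close>
  note PB = Fubini_bounded(3)[OF finite_measure_pos_part[of \<mu>] sets_pos_part fp *[OF sets_pos_part] p(1) le]
  note NB = Fubini_bounded(3)[OF finite_measure_pos_part[of \<mu>] sets_pos_part fn *[OF sets_neg_part] p(2) le]
  show "bdd_borel (\<lambda>x. sint \<nu> (\<lambda>y. h x y))"
    unfolding sint_def[of \<nu>] by (rule bdd_borel_diff[OF PB NB])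
  have "sint \<mu> (\<lambda>x. sint \<nu> (\<lambda>y. h x y)) = sint \<mu> (\<lambda>x. LINT y|pos_part \<nu>. h x y) - sint \<mu> (\<lambda>x. LINT y|neg_part \<nu>. h x y)"
    unfolding sint_def[of \<nu>] by (rule sint_diff_fun[OF PB NB])
  also have "\<dots> = sint \<nu> (\<lambda>y. sint \<mu> (\<lambda>x. h x y))"
    unfolding P(1) N(1) sint_def[of \<nu>] ..
  finally show "sint \<mu> (\<lambda>x. sint \<nu> (\<lambda>y. h x y)) = sint \<nu> (\<lambda>y. sint \<mu> (\<lambda>x. h x y))" .
qed


section \<open>Positive semidefiniteness of the convolution operator\<close>

lemma lborel_integral_affine_euclidean:
  fixes f :: "'a::euclidean_space \<Rightarrow> 'b::{banach, second_countable_topology}"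
  assumes [measurable]: "f \<in> borel_measurable borel" and c: "c \<noteq> 0"
  shows "(\<integral>x. f x \<partial>lborel) = \<bar>c\<bar> ^ DIM('a) *\<^sub>R (\<integral>x. f (t + c *\<^sub>R x) \<partial>lborel)"
    and "integrable lborel (\<lambda>x. f (t + c *\<^sub>R x)) \<longleftrightarrow> integrable lborel f"
proof -
  show "(\<integral>x. f x \<partial>lborel) = \<bar>c\<bar> ^ DIM('a) *\<^sub>R (\<integral>x. f (t + c *\<^sub>R x) \<partial>lborel)"
    by (subst lborel_affine[OF c, of t])
      (simp add: integral_density integral_distr del: ennreal_power)
  show "integrable lborel (\<lambda>x. f (t + c *\<^sub>R x)) \<longleftrightarrow> integrable lborel f"
  proof -
    let ?g = "\<lambda>x. f (t + c *\<^sub>R x)"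
    have "integrable lborel f \<longleftrightarrow> integrable lborel (\<lambda>x. \<bar>c\<bar> ^ DIM('a) *\<^sub>R ?g x)"
      by (subst lborel_affine[OF c, of t])
        (simp add: integrable_density integrable_distr_eq del: ennreal_power)
    also have "\<dots> \<longleftrightarrow> integrable lborel ?g"
      using integrable_scaleR_right[of "inverse (\<bar>c\<bar> ^ DIM('a))" lborel "\<lambda>x. \<bar>c\<bar> ^ DIM('a) *\<^sub>R ?g x"] c
      by (auto simp: power_inverse)
    finally show ?thesis ..
  qed
qed

text \<open>Lebesgue measure is the image of a product of one-dimensional Lebesgue measures, so
  integrands of product form factor. This reduces the Gaussian Fourier integral to dimension
  one.\<close>

lemma lborel_integral_prod:
  fixes f :: "'a::euclidean_space \<Rightarrow> real \<Rightarrow> complex"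
  assumes "\<And>b. b \<in> Basis \<Longrightarrow> integrable lborel (f b)"
  shows "(\<integral>x. (\<Prod>b\<in>Basis. f b (x \<bullet> b)) \<partial>lborel) = (\<Prod>b\<in>Basis. (\<integral>x. f b x \<partial>lborel))"
proof -
  interpret product_sigma_finite "\<lambda>_::'a. lborel :: real measure" ..
  have [measurable]: "f b \<in> borel_measurable borel" if "b \<in> Basis" for b
    using assms[OF that] by auto
  have "(\<integral>x. (\<Prod>b\<in>Basis. f b (x \<bullet> b)) \<partial>lborel) =
    (\<integral>y. (\<Prod>b\<in>Basis. f b ((\<Sum>j\<in>Basis. y j *\<^sub>R j) \<bullet> b)) \<partial>(\<Pi>\<^sub>M b\<in>(Basis::'a set). lborel))"
    by (subst lborel_eq, subst integral_distr) auto
  also have "\<dots> = (\<integral>y. (\<Prod>b\<in>Basis. f b (y b)) \<partial>(\<Pi>\<^sub>M b\<in>(Basis::'a set). lborel))"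
    by (intro Bochner_Integration.integral_cong refl prod.cong) simp
  also have "\<dots> = (\<Prod>b\<in>Basis. (\<integral>x. f b x \<partial>lborel))"
    using assms by (intro product_integral_prod) auto
  finally show ?thesis .
qed

lemma borel_measurable_cis [measurable]: "cis \<in> borel_measurable borel"
  by (intro borel_measurable_continuous_onI continuous_intros)

text \<open>The standard normal density on the space, written as a product over coordinates so that
  its integrals factor; \<open>gauss_eq\<close> supplies the radial form.\<close>

definition gauss :: "'a::euclidean_space \<Rightarrow> real"
  where "gauss x = (\<Prod>b\<in>Basis. std_normal_density (x \<bullet> b))"

lemma gauss_eq: "gauss (x::'a::euclidean_space) = (1 / sqrt (2 * pi)) ^ DIM('a) * exp (- (norm x)\<^sup>2 / 2)"
proof -
  have "(\<Sum>b\<in>Basis. - (x \<bullet> b)\<^sup>2 / 2) = - (norm x)\<^sup>2 / 2"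
    unfolding power2_norm_eq_inner euclidean_inner[of x x]
    by (simp add: sum_negf power2_eq_square flip: sum_divide_distrib)
  then show ?thesis
    unfolding gauss_def std_normal_density_def prod.distrib prod_constant exp_sum[OF finite_Basis, symmetric]
    by simp
qed

lemma gauss_nonneg: "0 \<le> gauss x"
  by (auto simp: gauss_def intro!: prod_nonneg)

lemma gauss_le_1: "gauss x \<le> 1"
proof -
  have "1 / sqrt (2 * pi) \<le> 1"
    using pi_ge_two by (simp add: real_le_rsqrt)
  then show ?thesis
    unfolding gauss_eq by (intro mult_le_one power_le_one) auto
qed

lemma borel_measurable_gauss [measurable]: "gauss \<in> borel_measurable borel"
  unfolding gauss_def by measurable

lemma integrable_gauss: "integrable lborel (gauss :: 'a::euclidean_space \<Rightarrow> real)"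
proof (rule integrableI_nonneg)
  have "(\<integral>\<^sup>+x. ennreal (gauss x) \<partial>(lborel::'a measure)) =
    (\<integral>\<^sup>+x. (\<Prod>b\<in>Basis. ennreal (std_normal_density (x \<bullet> b))) \<partial>(lborel::'a measure))"
    unfolding gauss_def by (simp add: prod_ennreal)
  also have "\<dots> = (\<Prod>b\<in>(Basis::'a set). (\<integral>\<^sup>+x. std_normal_density x \<partial>lborel))"
    by (rule nn_integral_lborel_prod) auto
  also have "\<dots> = 1"
    using prob_space.emeasure_space_1[OF prob_space_normal_density[of 1 0]]
    by (simp add: emeasure_density)
  finally show "(\<integral>\<^sup>+x. ennreal (gauss x) \<partial>(lborel::'a measure)) < \<infinity>" by simp
qed (auto simp: gauss_nonneg)

text \<open>The integrand factors over the coordinates, and each factor integrates to the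
  characteristic function of the standard normal distribution.\<close>

lemma Fourier_gauss:
  fixes u :: "'a::euclidean_space"
  shows "(\<integral>t. complex_of_real (gauss t) * cis (t \<bullet> u) \<partial>lborel) = complex_of_real (exp (- (norm u)\<^sup>2 / 2))"
proof -
  have int: "integrable lborel (\<lambda>x. complex_of_real (std_normal_density x) * cis (x * c))" for c :: real
    by (rule Bochner_Integration.integrable_bound[OF integrable_normal_density[of 1 0]])
       (auto simp: norm_mult)
  have char: "(\<integral>x. complex_of_real (std_normal_density x) * cis (x * c) \<partial>lborel) = complex_of_real (exp (- c\<^sup>2 / 2))" for c :: real
  proof -
    have "(\<integral>x. complex_of_real (std_normal_density x) * cis (x * c) \<partial>lborel) =
        (\<integral>x. std_normal_density x *\<^sub>R iexp (c * x) \<partial>lborel)"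
      by (intro Bochner_Integration.integral_cong refl) (simp add: cis_conv_exp mult_ac scaleR_conv_of_real)
    also have "\<dots> = char std_normal_distribution c"
      unfolding char_def by (rule integral_density[symmetric]) auto
    finally show ?thesis by (simp only: char_std_normal_distribution)
  qed
  have "cis (t \<bullet> u) = (\<Prod>b\<in>Basis. cis ((t \<bullet> b) * (u \<bullet> b)))" for t
    by (subst euclidean_inner) (simp add: cis_conv_exp exp_sum sum_distrib_left)
  then have "(\<integral>t. complex_of_real (gauss t) * cis (t \<bullet> u) \<partial>lborel) =
    (\<integral>t. (\<Prod>b\<in>Basis. complex_of_real (std_normal_density (t \<bullet> b)) * cis ((t \<bullet> b) * (u \<bullet> b))) \<partial>lborel)"
    by (simp add: gauss_def prod.distrib)
  also have "\<dots> = (\<Prod>b\<in>Basis. complex_of_real (exp (- (u \<bullet> b)\<^sup>2 / 2)))"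
    by (subst lborel_integral_prod) (simp_all add: int char)
  also have "\<dots> = complex_of_real (\<Prod>b\<in>Basis. exp (- (u \<bullet> b)\<^sup>2 / 2))" by simp
  also have "(\<Prod>b\<in>Basis. exp (- (u \<bullet> b)\<^sup>2 / 2)) = exp (\<Sum>b\<in>Basis. - (u \<bullet> b)\<^sup>2 / 2)"
    by (simp add: exp_sum)
  also have "(\<Sum>b\<in>Basis. - (u \<bullet> b)\<^sup>2 / 2) = - (norm u)\<^sup>2 / 2"
    unfolding power2_norm_eq_inner euclidean_inner[of u u]
    by (simp add: sum_negf power2_eq_square flip: sum_divide_distrib)
  finally show ?thesis .
qed

text \<open>
  The weight \<open>gwt s\<close> is the Gaussian density of variance \<open>s\<^sup>2\<close>; the kernel \<open>gker s\<close> is its Fourier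
  transform, which concentrates at \<open>0\<close> as \<open>s \<rightarrow> \<infinity>\<close>.
\<close>

definition gwt :: "real \<Rightarrow> 'a::euclidean_space \<Rightarrow> real"
  where "gwt s \<xi> = gauss (\<xi> /\<^sub>R s) * inverse s ^ DIM('a)"

definition gker :: "real \<Rightarrow> 'a::euclidean_space \<Rightarrow> real"
  where "gker s z = exp (- (norm ((2 * pi * s) *\<^sub>R z))\<^sup>2 / 2)"

lemma borel_measurable_gwt [measurable]: "gwt s \<in> borel_measurable borel"
  unfolding gwt_def by measurable

lemma borel_measurable_gker [measurable]: "gker s \<in> borel_measurable borel"
  unfolding gker_def by measurable

lemma gwt_nonneg: "0 < s \<Longrightarrow> 0 \<le> gwt s x"
  by (simp add: gwt_def gauss_nonneg)

lemma integrable_gwt: assumes "0 < s" shows "integrable lborel (gwt s)"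
  using lborel_integral_affine_euclidean(2)[OF borel_measurable_gauss, of "inverse s" 0] assms
  by (simp add: gwt_def[abs_def] integrable_gauss)

text \<open>Substituting \<open>\<xi> = s *\<^sub>R t\<close> reduces this to
  \<open>Fourier_gauss\<close> at frequency \<open>(2 * pi * s) *\<^sub>R z\<close>; the power of
  \<open>inverse s\<close> in \<open>gwt\<close> is the Jacobian.\<close>

lemma Fourier_gwt:
  fixes z :: "'a::euclidean_space"
  assumes s: "0 < s"
  shows "(\<integral>\<xi>. complex_of_real (gwt s \<xi>) * cis (2 * pi * (z \<bullet> \<xi>)) \<partial>lborel) = complex_of_real (gker s z)"
proof -
  let ?u = "(2 * pi * s) *\<^sub>R z"
  have "complex_of_real (gker s z) = (\<integral>t. complex_of_real (gauss t) * cis (t \<bullet> ?u) \<partial>lborel)"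
    by (simp only: Fourier_gauss gker_def)
  also have "\<dots> = \<bar>inverse s\<bar> ^ DIM('a) *\<^sub>R (\<integral>\<xi>. complex_of_real (gauss (0 + inverse s *\<^sub>R \<xi>)) * cis ((0 + inverse s *\<^sub>R \<xi>) \<bullet> ?u) \<partial>lborel)"
    using s by (intro lborel_integral_affine_euclidean(1)) auto
  also have "\<dots> = (\<integral>\<xi>. inverse s ^ DIM('a) *\<^sub>R (complex_of_real (gauss (inverse s *\<^sub>R \<xi>)) * cis ((inverse s *\<^sub>R \<xi>) \<bullet> ?u)) \<partial>lborel)"
    using s by simp
  also have "\<dots> = (\<integral>\<xi>. complex_of_real (gwt s \<xi>) * cis (2 * pi * (z \<bullet> \<xi>)) \<partial>lborel)"
    using s by (intro Bochner_Integration.integral_cong refl)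
      (simp add: gwt_def scaleR_conv_of_real inner_commute field_simps)
  finally show ?thesis ..
qed

text \<open>A bounded integrable function is square-integrable. This makes the weight admissible
  against the mean-square limit that defines the transform of \<open>\<rho>\<close>.\<close>

lemma integrable_gwt_square:
  assumes s: "0 < s" shows "integrable lborel (\<lambda>x. (gwt s x)\<^sup>2)"
proof (rule Bochner_Integration.integrable_bound[OF integrable_mult_right[OF integrable_gwt[OF s], of "inverse s ^ DIM('a)"]])
  have "gwt s x \<le> inverse s ^ DIM('a)" for x :: 'a
    using s mult_right_mono[OF gauss_le_1[of "x /\<^sub>R s"], of "inverse s ^ DIM('a)"] by (simp add: gwt_def)
  then show "AE x::'a in lborel. norm ((gwt s x)\<^sup>2) \<le> norm (inverse s ^ DIM('a) * gwt s x)"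
    using s by (auto simp: power2_eq_square abs_mult gwt_nonneg intro!: mult_right_mono)
qed measurable

lemma integrable_exp_norm_square:
  "integrable lborel (\<lambda>x::'a::euclidean_space. exp (- (norm x)\<^sup>2 / 2))"
  using integrable_gauss[where 'a='a] unfolding gauss_eq by simp

text \<open>The Fourier integral of \<open>gauss\<close> at frequency \<open>0\<close> is
  \<open>1\<close>, so the unnormalised integral cannot vanish. Positivity allows this mass to be
  cancelled once the smoothing has been removed.\<close>

lemma integral_exp_norm_square_pos:
  "0 < (\<integral>x. exp (- (norm x)\<^sup>2 / 2) \<partial>(lborel::'a::euclidean_space measure))"
proof -
  have "(\<integral>t. complex_of_real (gauss (t::'a)) \<partial>lborel) = 1"
    using Fourier_gauss[of "0::'a"] by simp
  then have "(\<integral>t. gauss (t::'a) \<partial>lborel) = 1"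
    by simp
  then have "(1 / sqrt (2 * pi)) ^ DIM('a) * (\<integral>x. exp (- (norm x)\<^sup>2 / 2) \<partial>(lborel::'a measure)) = 1"
    unfolding gauss_eq by simp
  then have "(\<integral>x. exp (- (norm x)\<^sup>2 / 2) \<partial>(lborel::'a measure)) \<noteq> 0"
    by (metis mult_zero_right zero_neq_one)
  moreover have "0 \<le> (\<integral>x. exp (- (norm x)\<^sup>2 / 2) \<partial>(lborel::'a measure))"
    by (rule Bochner_Integration.integral_nonneg) simp
  ultimately show ?thesis by linarith
qed

lemma integrable_gker:
  fixes a :: "'a::euclidean_space"
  assumes s: "0 < s" shows "integrable lborel (\<lambda>z. gker s (z - a))"
proof -
  have "integrable lborel (\<lambda>z::'a. exp (- (norm (-((2 * pi * s) *\<^sub>R a) + (2 * pi * s) *\<^sub>R z))\<^sup>2 / 2))"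
    using s by (subst lborel_integral_affine_euclidean(2)) (auto simp: integrable_exp_norm_square[simplified])
  then show ?thesis by (simp add: gker_def algebra_simps)
qed

section \<open>Fourier representation of the smoothed kernel\<close>

lemma smoothed_eq_Fourier_truncated:
  fixes \<rho> :: "'a::euclidean_space \<Rightarrow> real"
  assumes \<rho>: "\<rho> \<in> borel_measurable borel" "integrable lborel \<rho>" and s: "0 < s"
  shows "complex_of_real (\<integral>z. \<rho> z * gker s (z - a) \<partial>lborel) =
    (\<integral>\<xi>. complex_of_real (gwt s \<xi>) * cis (2 * pi * (a \<bullet> \<xi>)) *
      (\<integral>x. complex_of_real (\<rho> x) * cis (- 2 * pi * (x \<bullet> \<xi>)) \<partial>lborel) \<partial>lborel)"
proof -
  note [measurable] = \<rho>(1)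
  let ?h = "\<lambda>z \<xi>. complex_of_real (\<rho> z) * (complex_of_real (gwt s \<xi>) * cis (2 * pi * ((a - z) \<bullet> \<xi>)))"
  have split: "cis (2 * pi * ((a - z) \<bullet> \<xi>)) = cis (2 * pi * (a \<bullet> \<xi>)) * cis (- 2 * pi * (z \<bullet> \<xi>))" for z \<xi> :: 'a
    by (simp add: cis_mult inner_diff_left algebra_simps)
  \<comment> \<open>\<open>gker s\<close> is even, so \<open>z - a\<close> may become
    \<open>a - z\<close>; \<open>Fourier_gwt\<close> then replaces the kernel by an integral over
    frequencies.\<close>
  have "complex_of_real (\<integral>z. \<rho> z * gker s (z - a) \<partial>lborel) =
    (\<integral>z. complex_of_real (\<rho> z) * complex_of_real (gker s (a - z)) \<partial>lborel)"
    by (simp add: gker_def norm_minus_commute flip: integral_complex_of_real of_real_mult)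
  also have "\<dots> = (\<integral>z. \<integral>\<xi>. ?h z \<xi> \<partial>lborel \<partial>lborel)"
    unfolding Fourier_gwt[OF s, symmetric] by (simp add: mult.assoc)
  also have "\<dots> = (\<integral>\<xi>. \<integral>z. ?h z \<xi> \<partial>lborel \<partial>lborel)"
  \<comment> \<open>The double integrand has modulus
    \<open>\<bar>\<rho> z\<bar> * gwt s \<xi>\<close>, a product of two integrable
    functions.\<close>
  proof (rule lborel_pair.Fubini_integral[symmetric], rule lborel_pair.Fubini_integrable)
    have "(\<integral>\<xi>. norm (?h z \<xi>) \<partial>lborel) = \<bar>\<rho> z\<bar> * (\<integral>\<xi>. gwt s (\<xi>::'a) \<partial>lborel)" for z
      using s by (simp add: norm_mult gwt_nonneg)
    then show "integrable lborel (\<lambda>x. \<integral>y. norm (case (x, y) of (x, y) \<Rightarrow> ?h x y) \<partial>lborel)"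
      using \<rho>(2) by simp
    have "integrable lborel (\<lambda>\<xi>. ?h z \<xi>)" for z
      by (intro Bochner_Integration.integrable_bound[OF integrable_mult_right[OF integrable_gwt[OF s], of "\<rho> z"]])
        (auto simp: norm_mult)
    then show "AE x in lborel. integrable lborel (\<lambda>y. case (x, y) of (x, y) \<Rightarrow> ?h x y)"
      by simp
  qed measurable
  also have "\<dots> = (\<integral>\<xi>. \<integral>z. complex_of_real (gwt s \<xi>) * cis (2 * pi * (a \<bullet> \<xi>)) *
      (complex_of_real (\<rho> z) * cis (- 2 * pi * (z \<bullet> \<xi>))) \<partial>lborel \<partial>lborel)"
    unfolding split by (simp add: mult_ac)
  finally show ?thesis by simp
qed

lemma integrable_mult_of_squares:
  fixes w :: "'a \<Rightarrow> real" and g :: "'a \<Rightarrow> complex"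
  assumes [measurable]: "w \<in> borel_measurable M" "g \<in> borel_measurable M"
    and "integrable M (\<lambda>x. (w x)\<^sup>2)" "integrable M (\<lambda>x. (cmod (g x))\<^sup>2)"
  shows "integrable M (\<lambda>x. complex_of_real (w x) * g x)"
proof (rule Bochner_Integration.integrable_bound[OF Bochner_Integration.integrable_add[OF assms(3,4)]])
  have "\<bar>w x\<bar> * cmod (g x) \<le> (w x)\<^sup>2 + (cmod (g x))\<^sup>2" for x
    using sum_squares_bound[of "\<bar>w x\<bar>" "cmod (g x)"] mult_nonneg_nonneg[OF abs_ge_zero[of "w x"] norm_ge_zero[of "g x"]]
    unfolding power2_abs by (simp only: mult.assoc)
  then show "AE x in M. norm (complex_of_real (w x) * g x) \<le> norm ((w x)\<^sup>2 + (cmod (g x))\<^sup>2)"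
    by (simp add: norm_mult)
qed measurable

text \<open>Cauchy-Schwarz against the square-integrable weight \<open>w\<close>, carried out with
  nonnegative integrals to match the form of the limit in
  \<open>L2_fourier_transform\<close>.\<close>

lemma integral_tendsto_L2:
  fixes w :: "'a \<Rightarrow> complex" and g :: "'a \<Rightarrow> complex" and G :: "nat \<Rightarrow> 'a \<Rightarrow> complex"
  assumes [measurable]: "w \<in> borel_measurable M" "g \<in> borel_measurable M" "\<And>n. G n \<in> borel_measurable M"
    and w2: "integrable M (\<lambda>x. (cmod (w x))\<^sup>2)"
    and ig: "integrable M (\<lambda>x. w x * g x)" and iG: "\<And>n. integrable M (\<lambda>x. w x * G n x)"
    and lim: "(\<lambda>n. \<integral>\<^sup>+x. ennreal ((cmod (g x - G n x))\<^sup>2) \<partial>M) \<longlonglongrightarrow> 0"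
  shows "(\<lambda>n. \<integral>x. w x * G n x \<partial>M) \<longlonglongrightarrow> (\<integral>x. w x * g x \<partial>M)"
proof -
  let ?d = "\<lambda>n. (\<integral>x. w x * g x \<partial>M) - (\<integral>x. w x * G n x \<partial>M)"
  let ?C = "\<integral>\<^sup>+x. ennreal ((cmod (w x))\<^sup>2) \<partial>M"
  have C: "?C < \<infinity>"
    using w2 by (simp add: integrable_iff_bounded)
  have le: "ennreal ((cmod (?d n))\<^sup>2) \<le> ?C * (\<integral>\<^sup>+x. ennreal ((cmod (g x - G n x))\<^sup>2) \<partial>M)" for n
  proof -
    have "?d n = (\<integral>x. w x * (g x - G n x) \<partial>M)"
      using ig iG by (simp add: right_diff_distrib)
    then have "ennreal (cmod (?d n)) \<le> (\<integral>\<^sup>+x. norm (w x * (g x - G n x)) \<partial>M)"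
      using ig iG by (simp only:) (intro integral_norm_bound_ennreal, simp add: right_diff_distrib)
    also have "\<dots> = (\<integral>\<^sup>+x. ennreal (cmod (w x)) * ennreal (cmod (g x - G n x)) \<partial>M)"
      by (simp add: norm_mult ennreal_mult)
    finally have "ennreal (cmod (?d n)) ^ 2 \<le> (\<integral>\<^sup>+x. ennreal (cmod (w x)) * ennreal (cmod (g x - G n x)) \<partial>M)^2"
      by (rule power_mono) simp
    also have "\<dots> \<le> (\<integral>\<^sup>+x. ennreal (cmod (w x)) ^ 2 \<partial>M) * (\<integral>\<^sup>+x. ennreal (cmod (g x - G n x)) ^ 2 \<partial>M)"
      by (rule Cauchy_Schwarz_nn_integral) auto
    finally show ?thesis by (simp add: ennreal_power)
  qed
  \<comment> \<open>Finiteness of \<open>?C\<close> matters: multiplication by infinity is not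
    continuous at \<open>0\<close> in \<open>ennreal\<close>.\<close>
  have limC: "(\<lambda>n. ?C * (\<integral>\<^sup>+x. ennreal ((cmod (g x - G n x))\<^sup>2) \<partial>M)) \<longlonglongrightarrow> ?C * 0"
    using C by (intro ennreal_tendsto_cmult lim) (simp add: infinity_ennreal_def)
  have "(\<lambda>n. ennreal ((cmod (?d n))\<^sup>2)) \<longlonglongrightarrow> 0"
    by (rule tendsto_sandwich[OF _ _ tendsto_const limC[simplified mult_zero_right]]) (auto simp: le)
  then have "(\<lambda>n. (cmod (?d n))\<^sup>2) \<longlonglongrightarrow> 0"
    by (subst (asm) ennreal_0[symmetric], subst (asm) tendsto_ennreal_iff) auto
  then have "(\<lambda>n. sqrt ((cmod (?d n))\<^sup>2)) \<longlonglongrightarrow> sqrt 0"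
    by (rule tendsto_real_sqrt)
  then have "?d \<longlonglongrightarrow> 0"
    by (simp add: tendsto_norm_zero_iff)
  then have "(\<lambda>n. (\<integral>x. w x * g x \<partial>M) - ?d n) \<longlonglongrightarrow> (\<integral>x. w x * g x \<partial>M) - 0"
    by (intro tendsto_intros)
  then show ?thesis by simp
qed

text \<open>
  Only the Gaussian has to be Fourier-inverted here, and the \<open>L\<^sup>2\<close> limit that defines the transform of \<open>\<rho>\<close>
  is tested against a square-integrable weight, so no Plancherel theorem is needed.
\<close>

lemma smoothed_eq_Fourier:
  fixes \<rho> :: "'a::euclidean_space \<Rightarrow> real"
  assumes \<rho>: "\<rho> \<in> borel_measurable borel" "\<And>x. \<bar>\<rho> x\<bar> \<le> C" and s: "0 < s"
    and g: "L2_fourier_transform \<rho> g"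
  shows "complex_of_real (\<integral>z. \<rho> z * gker s (z - a) \<partial>lborel) =
    (\<integral>\<xi>. complex_of_real (gwt s \<xi>) * cis (2 * pi * (a \<bullet> \<xi>)) * g \<xi> \<partial>lborel)"
proof (rule LIMSEQ_unique)
  note [measurable] = \<rho>(1)
  \<comment> \<open>The truncations to balls are integrable, so the identity is known for them, and
    \<open>G n\<close> is the Fourier integral over the ball of radius \<open>n\<close>. The
    frequency side converges by \<open>integral_tendsto_L2\<close>, the space side by dominated
    convergence, and the two limits must agree.\<close>
  define \<rho>n where "\<rho>n n z = indicator (cball 0 (real n)) z * \<rho> z" for n and z :: 'a
  define G where "G n \<xi> = (\<integral>x. complex_of_real (\<rho>n n x) * cis (- 2 * pi * (x \<bullet> \<xi>)) \<partial>lborel)" for n and \<xi> :: 'a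
  let ?w = "\<lambda>\<xi>::'a. complex_of_real (gwt s \<xi>) * cis (2 * pi * (a \<bullet> \<xi>))"
  have [measurable]: "\<rho>n n \<in> borel_measurable borel" for n
    unfolding \<rho>n_def by (intro borel_measurable_times borel_measurable_indicator \<rho>(1)) auto
  have int: "integrable lborel (\<rho>n n)" for n
  proof -
    have "integrable lborel (\<lambda>z::'a. C * indicator (cball 0 (real n)) z)"
      by (intro integrable_mult_right integrable_real_indicator emeasure_lborel_cball_finite) auto
    then show ?thesis
      by (rule Bochner_Integration.integrable_bound)
        (auto simp: \<rho>n_def abs_mult indicator_def intro!: AE_I2 order_trans[OF \<rho>(2)])
  qed
  have g_meas [measurable]: "g \<in> borel_measurable borel"
    and g2: "integrable lborel (\<lambda>\<xi>. (cmod (g \<xi>))\<^sup>2)"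
    using g by (auto simp: L2_fourier_transform_def)
  have G_meas [measurable]: "G n \<in> borel_measurable borel" for n
    unfolding G_def by measurable
  have Geq: "G n \<xi> = (LINT x:cball 0 (real n)|lborel. complex_of_real (\<rho> x) * cis (- 2 * pi * (x \<bullet> \<xi>)))" for n \<xi>
    unfolding G_def \<rho>n_def set_lebesgue_integral_def
    by (intro Bochner_Integration.integral_cong) (auto simp: indicator_def)
  show "(\<lambda>n. \<integral>\<xi>. ?w \<xi> * G n \<xi> \<partial>lborel) \<longlonglongrightarrow> (\<integral>\<xi>. ?w \<xi> * g \<xi> \<partial>lborel)"
  proof (rule integral_tendsto_L2)
    show "integrable lborel (\<lambda>x. (cmod (?w x))\<^sup>2)"
      using integrable_gwt_square[OF s, where 'a='a] s by (simp add: norm_mult)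
    have "integrable lborel (\<lambda>x. complex_of_real (gwt s x) * (cis (2 * pi * (a \<bullet> x)) * g x))"
      using g2 by (intro integrable_mult_of_squares integrable_gwt_square s) (auto simp: norm_mult)
    then show "integrable lborel (\<lambda>x. ?w x * g x)"
      by (simp add: mult.assoc)
    have bnd: "cmod (G n \<xi>) \<le> (\<integral>x. \<bar>\<rho>n n x\<bar> \<partial>lborel)" for n \<xi>
      unfolding G_def by (rule order_trans[OF integral_norm_bound]) (simp add: norm_mult)
    show "integrable lborel (\<lambda>x. ?w x * G n x)" for n
    proof (rule Bochner_Integration.integrable_bound[OF integrable_mult_left[OF integrable_gwt[OF s]]])
      show "AE x in lborel. norm (?w x * G n x) \<le> norm (gwt s x * (\<integral>x. \<bar>\<rho>n n x\<bar> \<partial>lborel))"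
        using bnd s by (auto simp: norm_mult abs_mult intro!: mult_left_mono)
    qed measurable
    show "(\<lambda>n. \<integral>\<^sup>+x. ennreal ((cmod (g x - G n x))\<^sup>2) \<partial>lborel) \<longlonglongrightarrow> 0"
      using g filterlim_real_sequentially unfolding L2_fourier_transform_def Geq
      by (auto intro: filterlim_compose)
  qed measurable
  have "(\<lambda>n. \<integral>z. \<rho>n n z * gker s (z - a) \<partial>lborel) \<longlonglongrightarrow> (\<integral>z. \<rho> z * gker s (z - a) \<partial>lborel)"
  proof (rule integral_dominated_convergence[where w="\<lambda>z. C * gker s (z - a)"])
    show "AE z in lborel. (\<lambda>n. \<rho>n n z * gker s (z - a)) \<longlonglongrightarrow> \<rho> z * gker s (z - a)"
    proof (rule AE_I2)
      fix z :: 'a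
      have "eventually (\<lambda>n. norm z \<le> real n) sequentially"
        by (meson eventually_sequentiallyI nat_ceiling_le_eq)
      then have "eventually (\<lambda>n. \<rho> z * gker s (z - a) = \<rho>n n z * gker s (z - a)) sequentially"
        by eventually_elim (simp add: \<rho>n_def)
      then show "(\<lambda>n. \<rho>n n z * gker s (z - a)) \<longlonglongrightarrow> \<rho> z * gker s (z - a)"
        by (rule tendsto_cong[THEN iffD1, rotated, OF tendsto_const])
    qed
    show "AE z in lborel. norm (\<rho>n n z * gker s (z - a)) \<le> C * gker s (z - a)" for n
      using \<rho>(2) order_trans[OF abs_ge_zero \<rho>(2)]
      by (auto simp: \<rho>n_def abs_mult indicator_def gker_def)
  qed (use integrable_gker[OF s, of a] in auto)
  then have "(\<lambda>n. complex_of_real (\<integral>z. \<rho>n n z * gker s (z - a) \<partial>lborel)) \<longlonglongrightarrow>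
      complex_of_real (\<integral>z. \<rho> z * gker s (z - a) \<partial>lborel)"
    by (rule tendsto_of_real)
  then show "(\<lambda>n. \<integral>\<xi>. ?w \<xi> * G n \<xi> \<partial>lborel) \<longlonglongrightarrow>
      complex_of_real (\<integral>z. \<rho> z * gker s (z - a) \<partial>lborel)"
    unfolding G_def by (subst (asm) smoothed_eq_Fourier_truncated) (auto intro: int s)
qed

text \<open>The left side is real, so only the real part of the Fourier integral counts; as
  \<open>g\<close> is real almost everywhere, this part is a cosine integral. A single weight
  \<open>w\<close> serves every \<open>a\<close>, as the quadratic form requires.\<close>

lemma smoothed_eq_cos_transform:
  fixes \<rho> :: "'a::euclidean_space \<Rightarrow> real"
  assumes \<rho>: "\<rho> \<in> borel_measurable borel" "\<And>x. \<bar>\<rho> x\<bar> \<le> C" and s: "0 < s"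
    and g: "L2_fourier_transform \<rho> g" "AE \<xi> in lborel. g \<xi> \<in> \<real>\<^sub>\<ge>\<^sub>0"
  obtains w where "integrable lborel w" "\<And>\<xi>. 0 \<le> w \<xi>"
    "\<And>a. (\<integral>z. \<rho> z * gker s (z - a) \<partial>lborel) = (\<integral>\<xi>. w \<xi> * cos (2 * pi * (a \<bullet> \<xi>)) \<partial>lborel)"
proof
  \<comment> \<open>\<open>g\<close> is nonnegative only almost everywhere. The \<open>max\<close>,
    like the real part, changes the weight on a null set only and makes it nonnegative at every
    point.\<close>
  let ?w = "\<lambda>\<xi>::'a. max 0 (gwt s \<xi> * Re (g \<xi>))"
  have g_meas [measurable]: "g \<in> borel_measurable borel"
    and g2: "integrable lborel (\<lambda>\<xi>. (cmod (g \<xi>))\<^sup>2)"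
    using g(1) by (auto simp: L2_fourier_transform_def)
  have i: "integrable lborel (\<lambda>x. complex_of_real (gwt s x) * (cis (2 * pi * (a \<bullet> x)) * g x))" for a
    using g2 by (intro integrable_mult_of_squares integrable_gwt_square s) (auto simp: norm_mult)
  show "integrable lborel ?w"
  proof (rule Bochner_Integration.integrable_bound[OF i[of 0]])
    show "AE x in lborel. norm (?w x) \<le> norm (complex_of_real (gwt s x) * (cis (2 * pi * (0 \<bullet> x)) * g x))"
    proof (rule AE_I2)
      fix x
      have "\<bar>gwt s x * Re (g x)\<bar> \<le> \<bar>gwt s x\<bar> * cmod (g x)"
        by (simp add: abs_mult mult_left_mono abs_Re_le_cmod)
      then show "norm (?w x) \<le> norm (complex_of_real (gwt s x) * (cis (2 * pi * (0 \<bullet> x)) * g x))"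
        by (simp add: norm_mult)
    qed
  qed measurable
  show "0 \<le> ?w \<xi>" for \<xi> by simp
  show "(\<integral>z. \<rho> z * gker s (z - a) \<partial>lborel) = (\<integral>\<xi>. ?w \<xi> * cos (2 * pi * (a \<bullet> \<xi>)) \<partial>lborel)" for a
  proof -
    have "(\<integral>z. \<rho> z * gker s (z - a) \<partial>lborel) =
        Re (\<integral>\<xi>. complex_of_real (gwt s \<xi>) * cis (2 * pi * (a \<bullet> \<xi>)) * g \<xi> \<partial>lborel)"
      by (subst smoothed_eq_Fourier[OF \<rho> s g(1), symmetric]) simp
    also have "\<dots> = (\<integral>\<xi>. Re (complex_of_real (gwt s \<xi>) * cis (2 * pi * (a \<bullet> \<xi>)) * g \<xi>) \<partial>lborel)"
      using i[of a] by (subst integral_Re) (auto simp: mult.assoc)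
    also have "\<dots> = (\<integral>\<xi>. ?w \<xi> * cos (2 * pi * (a \<bullet> \<xi>)) \<partial>lborel)"
    proof (rule integral_cong_AE)
      show "AE \<xi> in lborel. Re (complex_of_real (gwt s \<xi>) * cis (2 * pi * (a \<bullet> \<xi>)) * g \<xi>) = ?w \<xi> * cos (2 * pi * (a \<bullet> \<xi>))"
        using g(2)
      proof eventually_elim
        case (elim \<xi>)
        then obtain r where "g \<xi> = complex_of_real r" "0 \<le> r"
          by (auto simp: nonneg_Reals_def)
        then show ?case
          using gwt_nonneg[OF s, of \<xi>] by (simp add: max_def)
      qed
    qed measurable
    finally show ?thesis .
  qed
qed

section \<open>Quadratic form of a cosine transform\<close>

lemma sint_measurable:
  assumes h: "case_prod h \<in> borel_measurable (N \<Otimes>\<^sub>M borel)"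
  shows "(\<lambda>\<xi>. sint \<mu> (h \<xi>)) \<in> borel_measurable N"
proof -
  have *: "case_prod h \<in> borel_measurable (N \<Otimes>\<^sub>M M)" if "sets M = sets borel" for M :: "'b measure"
    using h measurable_cong_sets[OF sets_pair_measure_cong[OF refl that]] by metis
  show ?thesis
    unfolding sint_def
    using sigma_finite_measure.borel_measurable_lebesgue_integral[OF finite_measure.sigma_finite_measure[OF finite_measure_pos_part] *[OF sets_pos_part]]
      sigma_finite_measure.borel_measurable_lebesgue_integral[OF finite_measure.sigma_finite_measure[OF finite_measure_neg_part] *[OF sets_neg_part]]
    by (intro borel_measurable_diff)
qed

lemma abs_sint_le:
  assumes "f \<in> borel_measurable borel" "\<And>x. \<bar>f x\<bar> \<le> C"
  shows "\<bar>sint \<mu> f\<bar> \<le> C * norm \<mu>"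
proof -
  have bb: "bdd_borel f" "bdd_borel (\<lambda>x. \<bar>f x\<bar>)"
    using assms by (auto intro!: bdd_borelI[where C=C])
  have "\<bar>LINT x|pos_part \<mu>. f x\<bar> \<le> (LINT x|pos_part \<mu>. C)"
    by (rule order_trans[OF integral_abs_bound integral_mono])
      (auto intro!: integrable_pos_part bb bdd_borel_const assms)
  moreover have "\<bar>LINT x|neg_part \<mu>. f x\<bar> \<le> (LINT x|neg_part \<mu>. C)"
    by (rule order_trans[OF integral_abs_bound integral_mono])
      (auto intro!: integrable_neg_part bb bdd_borel_const assms)
  ultimately show ?thesis
    unfolding sint_def norm_signed_measure_def by (simp add: distrib_left mult.commute)
qed

text \<open>The addition theorem for \<open>cos (x - y)\<close> separates the variables, and two
  exchanges of integrals leave \<open>w * (A * A + B * B)\<close> under the integral. The factor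
  \<open>\<phi>\<close> is later the indicator of \<open>\<Omega>\<close>, which restricts both
  integrations.\<close>

lemma cos_transform_psd:
  fixes w :: "'a::euclidean_space \<Rightarrow> real" and \<phi> :: "'a \<Rightarrow> real"
  assumes w: "integrable lborel w" "\<And>\<xi>. 0 \<le> w \<xi>" and \<phi>: "bdd_borel \<phi>"
  shows "0 \<le> sint \<mu> (\<lambda>x. \<phi> x * sint \<mu> (\<lambda>y. \<phi> y * (\<integral>\<xi>. w \<xi> * cos (2 * pi * ((x - y) \<bullet> \<xi>)) \<partial>lborel)))"
proof -
  obtain D where D: "0 \<le> D" "\<And>x. \<bar>\<phi> x\<bar> \<le> D"
    using \<phi> bdd_borel_bound by metis
  have [measurable]: "\<phi> \<in> borel_measurable borel" "w \<in> borel_measurable borel"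
    using \<phi> w(1) by (auto simp: bdd_borel_def)
  let ?c = "\<lambda>x \<xi>::'a. cos (2 * pi * (x \<bullet> \<xi>))" and ?s = "\<lambda>x \<xi>::'a. sin (2 * pi * (x \<bullet> \<xi>))"
  \<comment> \<open>\<open>A\<close> and \<open>B\<close> are the real and imaginary parts of the
    Fourier transform, up to the sign convention, of \<open>\<mu>\<close> with density
    \<open>\<phi>\<close>.\<close>
  define A where "A \<xi> = sint \<mu> (\<lambda>x. \<phi> x * ?c x \<xi>)" for \<xi>
  define B where "B \<xi> = sint \<mu> (\<lambda>x. \<phi> x * ?s x \<xi>)" for \<xi>
  have A_meas [measurable]: "A \<in> borel_measurable borel"
    unfolding A_def by (rule sint_measurable) measurable
  have B_meas [measurable]: "B \<in> borel_measurable borel"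
    unfolding B_def by (rule sint_measurable) measurable
  have \<phi>c: "\<bar>\<phi> x * ?c y \<xi>\<bar> \<le> D" "\<bar>\<phi> x * ?s y \<xi>\<bar> \<le> D" for x y \<xi>
    using mult_mono[OF D(2)[of x] abs_cos_le_one, of "2 * pi * (y \<bullet> \<xi>)"]
      mult_mono[OF D(2)[of x] abs_sin_le_one, of "2 * pi * (y \<bullet> \<xi>)"] D(1)
    by (simp_all add: abs_mult)
  have bbc: "bdd_borel (\<lambda>x. \<phi> x * ?c x \<xi>)" "bdd_borel (\<lambda>x. \<phi> x * ?s x \<xi>)" for \<xi>
    using \<phi>c by (auto intro!: bdd_borelI[where C=D])
  have AB: "\<bar>A \<xi>\<bar> \<le> D * norm \<mu>" "\<bar>B \<xi>\<bar> \<le> D * norm \<mu>" for \<xi>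
    unfolding A_def B_def by (auto intro!: abs_sint_le \<phi>c)
  have inner: "sint \<mu> (\<lambda>y. \<phi> y * (\<integral>\<xi>. w \<xi> * ?c (x - y) \<xi> \<partial>lborel)) =
      (\<integral>\<xi>. w \<xi> * (?c x \<xi> * A \<xi> + ?s x \<xi> * B \<xi>) \<partial>lborel)" for x
  proof -
    have "sint \<mu> (\<lambda>y. \<phi> y * (\<integral>\<xi>. w \<xi> * ?c (x - y) \<xi> \<partial>lborel)) =
      sint \<mu> (\<lambda>y. (\<integral>\<xi>. \<phi> y * (w \<xi> * ?c (x - y) \<xi>) \<partial>lborel))"
      by simp
    also have "\<dots> = (\<integral>\<xi>. sint \<mu> (\<lambda>y. \<phi> y * (w \<xi> * ?c (x - y) \<xi>)) \<partial>lborel)"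
    proof (rule sint_Fubini(1))
      show "integrable lborel (\<lambda>\<xi>. D * w \<xi>)" using w by simp
      show "\<bar>\<phi> y * (w \<xi> * ?c (x - y) \<xi>)\<bar> \<le> D * w \<xi>" for y \<xi>
        using mult_right_mono[OF \<phi>c(1)[of y "x - y" \<xi>] w(2)[of \<xi>]] w(2)[of \<xi>]
        by (simp add: abs_mult mult_ac)
      show "(\<lambda>(y, \<xi>). \<phi> y * (w \<xi> * ?c (x - y) \<xi>)) \<in> borel_measurable (borel \<Otimes>\<^sub>M lborel)"
        by measurable
    qed (rule sigma_finite_lborel)
    also have "\<dots> = (\<integral>\<xi>. w \<xi> * (?c x \<xi> * A \<xi> + ?s x \<xi> * B \<xi>) \<partial>lborel)"
    proof (rule Bochner_Integration.integral_cong[OF refl])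
      fix \<xi>
      have "sint \<mu> (\<lambda>y. \<phi> y * (w \<xi> * ?c (x - y) \<xi>)) =
        sint \<mu> (\<lambda>y. (w \<xi> * ?c x \<xi>) * (\<phi> y * ?c y \<xi>) + (w \<xi> * ?s x \<xi>) * (\<phi> y * ?s y \<xi>))"
        by (simp add: inner_diff_left cos_diff right_diff_distrib algebra_simps)
      also have "\<dots> = (w \<xi> * ?c x \<xi>) * A \<xi> + (w \<xi> * ?s x \<xi>) * B \<xi>"
        unfolding A_def B_def
        by (subst sint_add_fun) (auto intro!: bdd_borel_mult bdd_borel_const bbc simp: sint_cmult)
      finally show "sint \<mu> (\<lambda>y. \<phi> y * (w \<xi> * ?c (x - y) \<xi>)) = w \<xi> * (?c x \<xi> * A \<xi> + ?s x \<xi> * B \<xi>)"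
        by (simp add: algebra_simps)
    qed
    finally show ?thesis .
  qed
  have "sint \<mu> (\<lambda>x. \<phi> x * sint \<mu> (\<lambda>y. \<phi> y * (\<integral>\<xi>. w \<xi> * ?c (x - y) \<xi> \<partial>lborel))) =
    sint \<mu> (\<lambda>x. (\<integral>\<xi>. \<phi> x * (w \<xi> * (?c x \<xi> * A \<xi> + ?s x \<xi> * B \<xi>)) \<partial>lborel))"
    unfolding inner by simp
  also have "\<dots> = (\<integral>\<xi>. sint \<mu> (\<lambda>x. \<phi> x * (w \<xi> * (?c x \<xi> * A \<xi> + ?s x \<xi> * B \<xi>))) \<partial>lborel)"
  proof (rule sint_Fubini(1))
    \<comment> \<open>The cosine and the sine term each contribute a factor \<open>D\<close> from
      \<open>\<phi>\<close> and a factor \<open>D * norm \<mu>\<close> from \<open>A\<close> or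
      \<open>B\<close>.\<close>
    show "integrable lborel (\<lambda>\<xi>. (2 * D * (D * norm \<mu>)) * w \<xi>)" using w by simp
    show "\<bar>\<phi> x * (w \<xi> * (?c x \<xi> * A \<xi> + ?s x \<xi> * B \<xi>))\<bar> \<le> (2 * D * (D * norm \<mu>)) * w \<xi>" for x \<xi>
    proof -
      have "\<bar>(\<phi> x * ?c x \<xi>) * A \<xi> + (\<phi> x * ?s x \<xi>) * B \<xi>\<bar> \<le>
          \<bar>\<phi> x * ?c x \<xi>\<bar> * \<bar>A \<xi>\<bar> + \<bar>\<phi> x * ?s x \<xi>\<bar> * \<bar>B \<xi>\<bar>"
        by (metis abs_mult abs_triangle_ineq)
      also have "\<dots> \<le> D * (D * norm \<mu>) + D * (D * norm \<mu>)"
        by (intro add_mono mult_mono \<phi>c AB) (auto simp: D)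
      finally have "w \<xi> * \<bar>(\<phi> x * ?c x \<xi>) * A \<xi> + (\<phi> x * ?s x \<xi>) * B \<xi>\<bar> \<le> w \<xi> * (2 * D * (D * norm \<mu>))"
        by (intro mult_left_mono w) simp
      moreover have "\<bar>\<phi> x * (w \<xi> * (?c x \<xi> * A \<xi> + ?s x \<xi> * B \<xi>))\<bar> =
          w \<xi> * \<bar>(\<phi> x * ?c x \<xi>) * A \<xi> + (\<phi> x * ?s x \<xi>) * B \<xi>\<bar>"
      proof -
        have "\<phi> x * (w \<xi> * (?c x \<xi> * A \<xi> + ?s x \<xi> * B \<xi>)) =
          w \<xi> * ((\<phi> x * ?c x \<xi>) * A \<xi> + (\<phi> x * ?s x \<xi>) * B \<xi>)"
          by (simp add: algebra_simps)
        then show ?thesis using w(2)[of \<xi>] by (simp only: abs_mult[of "w \<xi>"] abs_of_nonneg)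
      qed
      ultimately show ?thesis by (simp add: mult_ac)
    qed
    show "(\<lambda>(x, \<xi>). \<phi> x * (w \<xi> * (?c x \<xi> * A \<xi> + ?s x \<xi> * B \<xi>))) \<in> borel_measurable (borel \<Otimes>\<^sub>M lborel)"
      by measurable
  qed (rule sigma_finite_lborel)
  also have "\<dots> = (\<integral>\<xi>. w \<xi> * (A \<xi> * A \<xi> + B \<xi> * B \<xi>) \<partial>lborel)"
  proof (rule Bochner_Integration.integral_cong[OF refl])
    fix \<xi>
    have "sint \<mu> (\<lambda>x. \<phi> x * (w \<xi> * (?c x \<xi> * A \<xi> + ?s x \<xi> * B \<xi>))) =
      sint \<mu> (\<lambda>x. (w \<xi> * A \<xi>) * (\<phi> x * ?c x \<xi>) + (w \<xi> * B \<xi>) * (\<phi> x * ?s x \<xi>))"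
      by (simp add: algebra_simps)
    also have "\<dots> = (w \<xi> * A \<xi>) * A \<xi> + (w \<xi> * B \<xi>) * B \<xi>"
      by (subst sint_add_fun, (intro bdd_borel_mult bdd_borel_const bbc)+) (simp add: sint_cmult A_def B_def)
    finally show "sint \<mu> (\<lambda>x. \<phi> x * (w \<xi> * (?c x \<xi> * A \<xi> + ?s x \<xi> * B \<xi>))) = w \<xi> * (A \<xi> * A \<xi> + B \<xi> * B \<xi>)"
      by (simp add: algebra_simps)
  qed
  also have "\<dots> \<ge> 0"
    using w(2) by (intro Bochner_Integration.integral_nonneg) simp
  finally show ?thesis .
qed

section \<open>Removal of the smoothing\<close>

lemma gker_approx_identity:
  fixes \<rho> :: "'a::euclidean_space \<Rightarrow> real"
  assumes \<rho>: "continuous_on UNIV \<rho>" "\<And>x. \<bar>\<rho> x\<bar> \<le> C"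
  defines "P \<equiv> \<lambda>s a. (2 * pi * s) ^ DIM('a) * (\<integral>z. \<rho> z * gker s (z - a) \<partial>lborel)"
    and "I \<equiv> (\<integral>u. exp (- (norm u)\<^sup>2 / 2) \<partial>(lborel::'a measure))"
  shows "(\<lambda>n. P (real (Suc n)) a) \<longlonglongrightarrow> \<rho> a * I"
    and "0 < s \<Longrightarrow> \<bar>P s a\<bar> \<le> C * I"
    and "P s \<in> borel_measurable borel"
proof -
  have \<rho>m [measurable]: "\<rho> \<in> borel_measurable borel"
    using \<rho>(1) by (rule borel_measurable_continuous_onI)
  have C: "0 \<le> C" using order_trans[OF abs_ge_zero \<rho>(2)] .
  \<comment> \<open>Substituting \<open>z = a + inverse (2 * pi * s) *\<^sub>R u\<close> fixes the
    Gaussian weight and moves the scale into the argument of \<open>\<rho>\<close>; the prefactor of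
    \<open>P\<close> cancels the Jacobian. The weight is not normalised, hence the mass
    \<open>I\<close> in the limit and in the bound.\<close>
  have P_eq: "P s a = (\<integral>u. \<rho> (a + inverse (2 * pi * s) *\<^sub>R u) * exp (- (norm u)\<^sup>2 / 2) \<partial>lborel)"
    if s: "0 < s" for s a
  proof -
    define c where "c = inverse (2 * pi * s)"
    have c: "0 < c" using s by (simp add: c_def)
    have c': "2 * pi * s = inverse c" by (simp only: c_def inverse_inverse_eq)
    have "(\<integral>z. \<rho> z * gker s (z - a) \<partial>lborel) =
      \<bar>c\<bar> ^ DIM('a) *\<^sub>R (\<integral>u. \<rho> (a + c *\<^sub>R u) * gker s (a + c *\<^sub>R u - a) \<partial>lborel)"
      using c by (intro lborel_integral_affine_euclidean(1)) auto
    also have "(\<lambda>u::'a. gker s (a + c *\<^sub>R u - a)) = (\<lambda>u. exp (- (norm u)\<^sup>2 / 2))"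
      using c by (simp add: gker_def c')
    finally show ?thesis
      unfolding P_def c_def[symmetric] unfolding c'
      using c by (simp add: power_inverse)
  qed
  show "P s \<in> borel_measurable borel"
    unfolding P_def by measurable
  show "(\<lambda>n. P (real (Suc n)) a) \<longlonglongrightarrow> \<rho> a * I"
  proof -
    have "(\<lambda>n. \<integral>u. \<rho> (a + inverse (2 * pi * real (Suc n)) *\<^sub>R u) * exp (- (norm u)\<^sup>2 / 2) \<partial>lborel)
      \<longlonglongrightarrow> (\<integral>u. \<rho> a * exp (- (norm u)\<^sup>2 / 2) \<partial>(lborel::'a measure))"
    proof (rule integral_dominated_convergence[where w="\<lambda>u. C * exp (- (norm u)\<^sup>2 / 2)"])
      show "integrable lborel (\<lambda>u::'a. C * exp (- (norm u)\<^sup>2 / 2))"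
        by (intro integrable_mult_right integrable_exp_norm_square)
      show "AE u in lborel. (\<lambda>n. \<rho> (a + inverse (2 * pi * real (Suc n)) *\<^sub>R u) * exp (- (norm u)\<^sup>2 / 2))
        \<longlonglongrightarrow> \<rho> a * exp (- (norm u)\<^sup>2 / 2)"
      proof (rule AE_I2)
        fix u :: 'a
        have "(\<lambda>n. inverse (2 * pi) * inverse (real (Suc n))) \<longlonglongrightarrow> inverse (2 * pi) * 0"
          by (intro tendsto_mult tendsto_const LIMSEQ_inverse_real_of_nat)
        then have "(\<lambda>n. inverse (2 * pi * real (Suc n))) \<longlonglongrightarrow> 0"
          by (simp only: inverse_mult_distrib mult_zero_right mult.assoc)
        then have "(\<lambda>n. a + inverse (2 * pi * real (Suc n)) *\<^sub>R u) \<longlonglongrightarrow> a + 0 *\<^sub>R u"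
          by (intro tendsto_intros)
        then have "(\<lambda>n. a + inverse (2 * pi * real (Suc n)) *\<^sub>R u) \<longlonglongrightarrow> a"
          by simp
        then have "(\<lambda>n. \<rho> (a + inverse (2 * pi * real (Suc n)) *\<^sub>R u)) \<longlonglongrightarrow> \<rho> a"
          using \<rho>(1) by (intro isCont_tendsto_compose[of a \<rho>]) (auto simp: continuous_on_eq_continuous_at)
        then show "(\<lambda>n. \<rho> (a + inverse (2 * pi * real (Suc n)) *\<^sub>R u) * exp (- (norm u)\<^sup>2 / 2))
          \<longlonglongrightarrow> \<rho> a * exp (- (norm u)\<^sup>2 / 2)"
          by (intro tendsto_intros)
      qed
      show "AE u in lborel. norm (\<rho> (a + inverse (2 * pi * real (Suc n)) *\<^sub>R u) * exp (- (norm u)\<^sup>2 / 2))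
        \<le> C * exp (- (norm u)\<^sup>2 / 2)" for n
        using \<rho>(2) by (simp add: abs_mult)
    qed measurable
    then show ?thesis by (simp add: P_eq I_def)
  qed
  show "\<bar>P s a\<bar> \<le> C * I" if s: "0 < s"
  proof -
    have i: "integrable lborel (\<lambda>u::'a. C * exp (- (norm u)\<^sup>2 / 2))"
      by (intro integrable_mult_right integrable_exp_norm_square)
    have "\<bar>P s a\<bar> \<le> (\<integral>u. \<bar>\<rho> (a + inverse (2 * pi * s) *\<^sub>R u) * exp (- (norm u)\<^sup>2 / 2)\<bar> \<partial>lborel)"
      unfolding P_eq[OF s] by (rule integral_abs_bound)
    also have "\<dots> \<le> (\<integral>u. C * exp (- (norm u)\<^sup>2 / 2) \<partial>(lborel::'a measure))"
    proof (rule integral_mono)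
      show "integrable lborel (\<lambda>u. \<bar>\<rho> (a + inverse (2 * pi * s) *\<^sub>R u) * exp (- (norm u)\<^sup>2 / 2)\<bar>)"
        by (rule Bochner_Integration.integrable_bound[OF i]) (use \<rho>(2) C in \<open>auto simp: abs_mult\<close>)
    qed (use i \<rho>(2) in \<open>auto simp: abs_mult\<close>)
    finally show ?thesis by (simp add: I_def)
  qed
qed

text \<open>The smoothed kernels have nonnegative forms, and the bound \<open>C * I\<close>, uniform
  in \<open>n\<close>, lets dominated convergence pass through both integrations. The limit kernel
  is \<open>\<rho>\<close> times \<open>I\<close>, and \<open>I\<close> is positive.\<close>

lemma conv_op_psd:
  fixes \<rho> :: "'a::euclidean_space \<Rightarrow> real"
  assumes \<Omega>: "\<Omega> \<in> sets borel"
    and \<rho>: "continuous_on UNIV \<rho>" "\<And>x. \<bar>\<rho> x\<bar> \<le> C"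
    and g: "L2_fourier_transform \<rho> g" "AE \<xi> in lborel. g \<xi> \<in> \<real>\<^sub>\<ge>\<^sub>0"
  shows "0 \<le> pairing \<Omega> (conv_op \<Omega> \<rho> \<mu>) \<mu>"
proof -
  let ?i = "indicator \<Omega> :: 'a \<Rightarrow> real"
  define I where "I = (\<integral>u. exp (- (norm u)\<^sup>2 / 2) \<partial>(lborel::'a measure))"
  define P where "P n a = (2 * pi * real (Suc n)) ^ DIM('a) * (\<integral>z. \<rho> z * gker (real (Suc n)) (z - a) \<partial>lborel)"
    for n and a :: 'a
  have \<rho>m [measurable]: "\<rho> \<in> borel_measurable borel"
    using \<rho>(1) by (rule borel_measurable_continuous_onI)
  have Ipos: "0 < I" unfolding I_def by (rule integral_exp_norm_square_pos)
  have lim: "(\<lambda>n. P n a) \<longlonglongrightarrow> \<rho> a * I" for a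
    unfolding P_def I_def by (rule gker_approx_identity[OF \<rho>])
  have bnd: "\<bar>P n a\<bar> \<le> C * I" for n a
    unfolding P_def I_def by (rule gker_approx_identity[OF \<rho>]) simp
  have P_meas [measurable]: "P n \<in> borel_measurable borel" for n
    unfolding P_def[abs_def] by (rule gker_approx_identity[OF \<rho>])
  have ib: "bdd_borel ?i" using \<Omega> by (rule bdd_borel_indicator)
  have [measurable]: "?i \<in> borel_measurable borel" using \<Omega> by simp
  have CI: "0 \<le> C * I" using bnd[of 0 0] by linarith
  have m: "(\<lambda>y. ?i y * h (x - y)) \<in> borel_measurable borel"
    if [measurable]: "h \<in> borel_measurable borel" for h x
    by measurable
  define S where "S h = sint \<mu> (\<lambda>x. ?i x * sint \<mu> (\<lambda>y. ?i y * h (x - y)))" for h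
  have nn: "0 \<le> S (P n)" for n
  proof -
    obtain w where w: "integrable lborel w" "\<And>\<xi>. 0 \<le> w \<xi>"
      "\<And>a. (\<integral>z. \<rho> z * gker (real (Suc n)) (z - a) \<partial>lborel) = (\<integral>\<xi>. w \<xi> * cos (2 * pi * (a \<bullet> \<xi>)) \<partial>lborel)"
      using smoothed_eq_cos_transform[OF \<rho>m \<rho>(2) _ g, of "real (Suc n)"] by auto
    let ?c = "(2 * pi * real (Suc n)) ^ DIM('a)"
    have "S (P n) = ?c * sint \<mu> (\<lambda>x. ?i x * sint \<mu> (\<lambda>y. ?i y * (\<integral>\<xi>. w \<xi> * cos (2 * pi * ((x - y) \<bullet> \<xi>)) \<partial>lborel)))"
      unfolding S_def P_def w(3) mult.left_commute[of _ ?c] sint_cmult ..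
    then show ?thesis
      using cos_transform_psd[OF w(1,2) ib] by (auto intro!: mult_nonneg_nonneg)
  qed
  have bb: "bdd_borel (\<lambda>x. sint \<mu> (\<lambda>y. ?i y * h (x - y)))"
    if [measurable]: "h \<in> borel_measurable borel" and "\<And>a. \<bar>h a\<bar> \<le> D" for h D
  proof (rule sint_swap(2))
    show "(\<lambda>(x, y). ?i y * h (x - y)) \<in> borel_measurable borel"
      unfolding borel_prod[symmetric] by measurable
    show "\<bar>?i y * h (x - y)\<bar> \<le> D" for x y
      using that(2)[of "x - y"] by (auto simp: indicator_def)
  qed
  have "(\<lambda>n. S (P n)) \<longlonglongrightarrow> S (\<lambda>a. \<rho> a * I)"
    unfolding S_def
  proof (rule sint_tendsto)
    show "(\<lambda>n. ?i x * sint \<mu> (\<lambda>y. ?i y * P n (x - y))) \<longlonglongrightarrow> ?i x * sint \<mu> (\<lambda>y. ?i y * (\<rho> (x - y) * I))" for x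
      by (intro tendsto_mult tendsto_const sint_tendsto[where C="C * I"] lim m m[where h="\<lambda>a. \<rho> a * I"])
        (auto simp: indicator_def intro: bnd CI)
    have "\<bar>sint \<mu> (\<lambda>y. ?i y * P n (x - y))\<bar> \<le> C * I * norm \<mu>" for n x
      by (rule abs_sint_le[OF m[OF P_meas]]) (use bnd CI in \<open>auto simp: indicator_def\<close>)
    moreover have "0 \<le> C * I * norm \<mu>" using CI by simp
    ultimately show "\<bar>?i x * sint \<mu> (\<lambda>y. ?i y * P n (x - y))\<bar> \<le> C * I * norm \<mu>" for n x
      by (auto simp: indicator_def)
    show "(\<lambda>x. ?i x * sint \<mu> (\<lambda>y. ?i y * P n (x - y))) \<in> borel_measurable borel" for n
      by (rule bdd_borel_measurable[OF bdd_borel_mult[OF ib bb[OF P_meas bnd]]])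
    show "(\<lambda>x. ?i x * sint \<mu> (\<lambda>y. ?i y * (\<rho> (x - y) * I))) \<in> borel_measurable borel"
      by (rule bdd_borel_measurable[OF bdd_borel_mult[OF ib bb[where h="\<lambda>a. \<rho> a * I" and D="C * I"]]])
        (use \<rho>(2) Ipos in \<open>auto simp: abs_mult\<close>)
  qed
  then have "0 \<le> S (\<lambda>a. \<rho> a * I)"
    by (rule LIMSEQ_le_const) (auto simp: nn)
  also have "S (\<lambda>a. \<rho> a * I) = pairing \<Omega> (conv_op \<Omega> \<rho> \<mu>) \<mu> * I"
    unfolding S_def pairing_eq_sint conv_op_def
    by (simp only: mult.assoc[symmetric] sint_multc)
  finally show ?thesis
    using Ipos by (simp add: zero_le_mult_iff)
qed


section \<open>Convergence of the forward-backward method\<close>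

text \<open>Derivatives such as \<open>F' \<mu>\<close> are controlled on \<open>\<Omega>\<close>
  only and may be arbitrary elsewhere, so regularity is imposed after multiplication with the
  indicator.\<close>

abbreviation bdd_borel_on :: "'a::topological_space set \<Rightarrow> ('a \<Rightarrow> real) \<Rightarrow> bool"
  where "bdd_borel_on \<Omega> f \<equiv> bdd_borel (\<lambda>x. indicator \<Omega> x * f x)"

lemma bdd_borel_on_add: "bdd_borel_on \<Omega> f \<Longrightarrow> bdd_borel_on \<Omega> g \<Longrightarrow> bdd_borel_on \<Omega> (\<lambda>x. f x + g x)"
  using bdd_borel_add[of "\<lambda>x. indicator \<Omega> x * f x" "\<lambda>x. indicator \<Omega> x * g x"]
  by (simp add: distrib_left)

lemma bdd_borel_on_cmult: "bdd_borel_on \<Omega> f \<Longrightarrow> bdd_borel_on \<Omega> (\<lambda>x. c * f x)"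
  using bdd_borel_mult[OF bdd_borel_const[of c], of "\<lambda>x. indicator \<Omega> x * f x"]
  by (simp add: mult.left_commute)

lemma bdd_borel_on_const: "\<Omega> \<in> sets borel \<Longrightarrow> bdd_borel_on \<Omega> (\<lambda>_. c)"
  by (intro bdd_borel_mult bdd_borel_indicator bdd_borel_const)

lemma bdd_borel_on_min:
  fixes f :: "'a::topological_space \<Rightarrow> real"
  assumes f: "bdd_borel_on \<Omega> f" and \<Omega>: "\<Omega> \<in> sets borel"
  shows "bdd_borel_on \<Omega> (\<lambda>x. min c (f x))"
proof -
  obtain C where C: "\<And>x. \<bar>indicator \<Omega> x * f x\<bar> \<le> C" using bdd_borel_bound[OF f] by metis
  \<comment> \<open>\<open>f\<close> itself may fail to be measurable, so the minimum is taken with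
    the measurable \<open>g\<close> and cut off again; on \<open>\<Omega>\<close> the two
    agree.\<close>
  define g where "g x = indicator \<Omega> x * f x" for x
  have [measurable]: "g \<in> borel_measurable borel" "(indicator \<Omega> :: 'a \<Rightarrow> real) \<in> borel_measurable borel"
    using bdd_borel_measurable[OF f] \<Omega> by (auto simp: g_def[abs_def])
  have "(\<lambda>x. indicator \<Omega> x * min c (g x)) \<in> borel_measurable borel"
    by measurable
  also have "(\<lambda>x. indicator \<Omega> x * min c (g x)) = (\<lambda>x. indicator \<Omega> x * min c (f x))"
    by (auto simp: g_def indicator_def)
  finally have "(\<lambda>x. indicator \<Omega> x * min c (f x)) \<in> borel_measurable borel" .
  moreover have "\<bar>indicator \<Omega> x * min c (f x)\<bar> \<le> \<bar>c\<bar> + C" for x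
    using C[of x] by (auto simp: indicator_def min_def)
  ultimately show ?thesis by (rule bdd_borelI)
qed

lemma bdd_borel_on_continuous:
  fixes f :: "'a::euclidean_space \<Rightarrow> real"
  assumes "compact \<Omega>" "continuous_on \<Omega> f"
  shows "bdd_borel_on \<Omega> f"
proof -
  obtain C where C: "\<And>x. x \<in> \<Omega> \<Longrightarrow> norm (f x) \<le> C"
    using compact_imp_bounded[OF compact_continuous_image[OF assms(2,1)]]
    by (auto simp: bounded_iff)
  have "(\<lambda>x. indicator \<Omega> x *\<^sub>R f x) \<in> borel_measurable borel"
    using assms by (intro borel_measurable_continuous_on_indicator) (auto simp: borel_compact)
  \<comment> \<open>For empty \<open>\<Omega>\<close> the constant \<open>C\<close> may be negative,
    hence the absolute value.\<close>
  then show ?thesis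
    using C by (intro bdd_borelI[where C="\<bar>C\<bar>"]) (fastforce simp: indicator_def)+
qed

lemma pairing_diff: "bdd_borel_on \<Omega> f \<Longrightarrow> pairing \<Omega> f (\<mu> - \<nu>) = pairing \<Omega> f \<mu> - pairing \<Omega> f \<nu>"
  by (simp add: pairing_eq_sint sint_diff)

lemma pairing_add_fun:
  "bdd_borel_on \<Omega> f \<Longrightarrow> bdd_borel_on \<Omega> g \<Longrightarrow>
    pairing \<Omega> (\<lambda>x. f x + g x) \<mu> = pairing \<Omega> f \<mu> + pairing \<Omega> g \<mu>"
  by (simp add: pairing_eq_sint distrib_left sint_add_fun)

lemma pairing_cmult: "pairing \<Omega> (\<lambda>x. c * f x) \<mu> = c * pairing \<Omega> f \<mu>"
  by (simp add: pairing_eq_sint mult.left_commute[of _ c] sint_cmult)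

lemma pairing_mono:
  assumes "0 \<le> \<mu>" "bdd_borel_on \<Omega> f" "bdd_borel_on \<Omega> g" "\<And>x. x \<in> \<Omega> \<Longrightarrow> f x \<le> g x"
  shows "pairing \<Omega> f \<mu> \<le> pairing \<Omega> g \<mu>"
  unfolding pairing_eq_sint using assms by (intro sint_mono) (auto simp: indicator_def)

section \<open>Boundedness and symmetry of the convolution operator\<close>

lemma bdd_borel_conv_op:
  fixes \<rho> :: "'a::euclidean_space \<Rightarrow> real"
  assumes "\<Omega> \<in> sets borel" "\<rho> \<in> borel_measurable borel" "\<And>x. \<bar>\<rho> x\<bar> \<le> C"
  shows "bdd_borel (conv_op \<Omega> \<rho> \<mu>)"
proof -
  have [measurable]: "\<rho> \<in> borel_measurable borel" "(indicator \<Omega> :: 'a \<Rightarrow> real) \<in> borel_measurable borel"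
    using assms by auto
  have "bdd_borel (\<lambda>x. sint \<mu> (\<lambda>y. indicator \<Omega> y * \<rho> (x - y)))"
  proof (rule sint_swap(2))
    show "(\<lambda>(x, y). indicator \<Omega> y * \<rho> (x - y)) \<in> borel_measurable borel"
      unfolding borel_prod[symmetric] by measurable
    show "\<bar>indicator \<Omega> y * \<rho> (x - y)\<bar> \<le> C" for x y :: 'a
      using assms(3)[of "x - y"] by (auto simp: indicator_def)
  qed
  then show ?thesis
    by (simp add: conv_op_def[abs_def] pairing_eq_sint)
qed

text \<open>Fubini together with evenness of \<open>\<rho>\<close>. Symmetry of the form is what the
  three-point identity of the one-step estimate rests on.\<close>

lemma pairing_conv_op_commute:
  fixes \<rho> :: "'a::euclidean_space \<Rightarrow> real"
  assumes "\<Omega> \<in> sets borel" "\<rho> \<in> borel_measurable borel" "\<And>x. \<bar>\<rho> x\<bar> \<le> C" "\<And>y. \<rho> (- y) = \<rho> y"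
  shows "pairing \<Omega> (conv_op \<Omega> \<rho> \<mu>) \<nu> = pairing \<Omega> (conv_op \<Omega> \<rho> \<nu>) \<mu>"
proof -
  have [measurable]: "\<rho> \<in> borel_measurable borel" "(indicator \<Omega> :: 'a \<Rightarrow> real) \<in> borel_measurable borel"
    using assms by auto
  let ?h = "\<lambda>x y. indicator \<Omega> x * (indicator \<Omega> y * \<rho> (x - y))"
  have "pairing \<Omega> (conv_op \<Omega> \<rho> \<mu>) \<nu> = sint \<nu> (\<lambda>x. sint \<mu> (\<lambda>y. ?h x y))"
    by (simp add: pairing_eq_sint conv_op_def sint_cmult)
  also have "\<dots> = sint \<mu> (\<lambda>y. sint \<nu> (\<lambda>x. ?h x y))"
  proof (rule sint_swap(1))
    show "(\<lambda>(x, y). ?h x y) \<in> borel_measurable borel"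
      unfolding borel_prod[symmetric] by measurable
    show "\<bar>?h x y\<bar> \<le> C" for x y :: 'a
      using assms(3)[of "x - y"] order_trans[OF abs_ge_zero assms(3)] by (auto simp: indicator_def)
  qed
  also have "\<dots> = pairing \<Omega> (conv_op \<Omega> \<rho> \<nu>) \<mu>"
  proof -
    have "\<rho> (x - y) = \<rho> (y - x)" for x y
      using assms(4)[of "x - y"] by simp
    then have "?h x y = indicator \<Omega> y * (indicator \<Omega> x * \<rho> (y - x))" for x y
      by (simp add: mult.left_commute)
    then have "(\<lambda>y. sint \<nu> (\<lambda>x. ?h x y)) =
        (\<lambda>y. sint \<nu> (\<lambda>x. indicator \<Omega> y * (indicator \<Omega> x * \<rho> (y - x))))"
      by (intro ext arg_cong[where f="sint \<nu>"])
    then show ?thesis by (simp add: pairing_eq_sint conv_op_def sint_cmult)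
  qed
  finally show ?thesis .
qed

section \<open>Gradient inequality and estimates for one step\<close>

lemma convex_on_derivative_le:
  fixes f :: "'a::real_normed_vector \<Rightarrow> real"
  assumes cvx: "convex_on S f" and S: "x \<in> S" "y \<in> S"
    and D: "(f has_derivative D) (at x within S)"
  shows "D (y - x) \<le> f y - f x"
proof -
  \<comment> \<open>Along the segment from \<open>x\<close> to \<open>y\<close>, convexity keeps the
    difference quotients at \<open>x\<close> below \<open>f y - f x\<close>, and they tend to the
    directional derivative. The segment stays in \<open>S\<close>, so the derivative within
    \<open>S\<close> applies.\<close>
  define h where "h t = x + t *\<^sub>R (y - x)" for t :: real
  have hS: "h ` {0..1} \<subseteq> S"
  proof
    fix z assume "z \<in> h ` {0..1}"
    then obtain t where t: "0 \<le> t" "t \<le> 1" "z = (1 - t) *\<^sub>R x + t *\<^sub>R y"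
      by (auto simp: h_def algebra_simps)
    then show "z \<in> S"
      using convex_on_imp_convex[OF cvx] S by (auto simp: convex_alt)
  qed
  have "(h has_derivative (\<lambda>t. t *\<^sub>R (y - x))) (at 0 within {0..1})"
    unfolding h_def by (auto intro!: derivative_eq_intros)
  moreover have "(f has_derivative D) (at (h 0) within h ` {0..1})"
    using has_derivative_subset[OF D hS] by (simp add: h_def)
  ultimately have "((\<lambda>t. f (h t)) has_derivative (\<lambda>t. D (t *\<^sub>R (y - x)))) (at 0 within {0..1})"
    by (rule has_derivative_in_compose)
  moreover have "(\<lambda>t. D (t *\<^sub>R (y - x))) = (*) (D (y - x))"
    using linear_cmul[OF bounded_linear.linear[OF has_derivative_bounded_linear[OF D]]]
    by (auto simp: mult.commute)
  ultimately have "((\<lambda>t. f (h t)) has_real_derivative D (y - x)) (at 0 within {0..1})"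
    by (simp add: has_field_derivative_def)
  then have lim: "((\<lambda>t. (f (h t) - f x) / t) \<longlongrightarrow> D (y - x)) (at 0 within {0..1})"
    by (simp add: has_field_derivative_iff h_def)
  have "(f (h t) - f x) / t \<le> f y - f x" if "0 < t" "t \<le> 1" for t
  proof -
    have "f ((1 - t) *\<^sub>R x + t *\<^sub>R y) \<le> (1 - t) * f x + t * f y"
      using that by (intro convex_onD[OF cvx]) (auto simp: S)
    then have "f (h t) - f x \<le> t * (f y - f x)"
      by (simp add: h_def algebra_simps)
    then show ?thesis using that by (simp add: field_simps)
  qed
  then have "eventually (\<lambda>t. (f (h t) - f x) / t \<le> f y - f x) (at 0 within {0..1})"
    by (auto simp: eventually_at_filter)
  moreover have "at (0::real) within {0..1} \<noteq> bot"
    by (simp add: at_within_Icc_at_right)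
  ultimately show ?thesis
    using tendsto_upperbound[OF lim] by blast
qed

text \<open>Smoothness bounds \<open>F b\<close> from above and convexity bounds \<open>F c\<close>
  from below, both by linearisation at \<open>a\<close>; a three-point identity rewrites the
  proximal term. The comparison point \<open>c\<close> stays free: \<open>\<mu>bar\<close> will give
  the telescoping bound, the current iterate the approximate monotonicity.\<close>

lemma FB_descent:
  fixes \<rho> :: "'a::euclidean_space \<Rightarrow> real"
  assumes \<Omega>: "compact \<Omega>"
    and \<rho>: "continuous_on UNIV \<rho>" "\<And>x. \<bar>\<rho> x\<bar> \<le> C" "\<And>y. \<rho> (- y) = \<rho> y"
    and psd: "\<And>\<eta>. 0 \<le> pairing \<Omega> (conv_op \<Omega> \<rho> \<eta>) \<eta>"
    and F_convex: "convex_on (measures_on \<Omega>) F"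
    and F_diff: "is_pre_derivative \<Omega> F F'"
    and F_smooth: "F b - F a - pairing \<Omega> (F' a) (b - a) \<le> L / 2 * (norm_conv \<Omega> \<rho> (b - a))\<^sup>2"
    and step: "\<tau> > 0" "\<tau> * L \<le> 1"
    and abc: "a \<in> measures_on \<Omega>" "b \<in> measures_on \<Omega>" "c \<in> measures_on \<Omega>" "0 \<le> b" "0 \<le> c"
    and r: "r = (\<lambda>x. \<tau> * (F' a x + \<alpha>) + conv_op \<Omega> \<rho> (b - a) x)"
  shows "bdd_borel_on \<Omega> r"
    and "\<tau> * ((F b + \<alpha> * norm b) - (F c + \<alpha> * norm c)) \<le>
      pairing \<Omega> r (b - c) + (norm_conv \<Omega> \<rho> (a - c))\<^sup>2 / 2 - (norm_conv \<Omega> \<rho> (b - c))\<^sup>2 / 2"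
proof -
  have \<Omega>b: "\<Omega> \<in> sets borel" using \<Omega> by (rule borel_compact)
  have \<rho>m: "\<rho> \<in> borel_measurable borel"
    using \<rho>(1) by (rule borel_measurable_continuous_onI)
  define B where "B \<mu> \<nu> = pairing \<Omega> (conv_op \<Omega> \<rho> \<mu>) \<nu>" for \<mu> \<nu>
  have cb: "bdd_borel_on \<Omega> (conv_op \<Omega> \<rho> \<mu>)" for \<mu>
    by (intro bdd_borel_mult bdd_borel_indicator \<Omega>b bdd_borel_conv_op[OF _ \<rho>m \<rho>(2)])
  have B_sym: "B \<mu> \<nu> = B \<nu> \<mu>" for \<mu> \<nu>
    unfolding B_def by (rule pairing_conv_op_commute[OF \<Omega>b \<rho>m \<rho>(2,3)])
  have B_right: "B \<mu> (\<nu> - \<eta>) = B \<mu> \<nu> - B \<mu> \<eta>" for \<mu> \<nu> \<eta>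
    unfolding B_def by (rule pairing_diff[OF cb])
  have B_left: "B (\<nu> - \<eta>) \<mu> = B \<nu> \<mu> - B \<eta> \<mu>" for \<mu> \<nu> \<eta>
    using B_right B_sym by metis
  have Q: "(norm_conv \<Omega> \<rho> \<mu>)\<^sup>2 = B \<mu> \<mu>" for \<mu>
    unfolding norm_conv_def B_def using psd by simp
  have Fb: "bdd_borel_on \<Omega> (F' a)"
    using F_diff abc \<Omega> by (intro bdd_borel_on_continuous) (auto simp: is_pre_derivative_def)
  have Fab: "bdd_borel_on \<Omega> (\<lambda>x. \<tau> * (F' a x + \<alpha>))"
    by (intro bdd_borel_on_cmult bdd_borel_on_add Fb bdd_borel_on_const \<Omega>b)
  show rb: "bdd_borel_on \<Omega> r"
    unfolding r by (intro bdd_borel_on_add Fab cb)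
  have "pairing \<Omega> r (b - c) = \<tau> * (pairing \<Omega> (F' a) (b - c) + pairing \<Omega> (\<lambda>_. \<alpha>) (b - c)) + B (b - a) (b - c)"
    unfolding r B_def
    by (subst pairing_add_fun[OF Fab cb])
      (simp add: pairing_cmult pairing_add_fun[OF Fb bdd_borel_on_const[OF \<Omega>b]])
  moreover have "pairing \<Omega> (\<lambda>_. \<alpha>) (b - c) = \<alpha> * norm b - \<alpha> * norm c"
    using abc by (simp add: pairing_diff[OF bdd_borel_on_const[OF \<Omega>b]] norm_eq_pairing \<Omega>b)
  \<comment> \<open>The three-point identity, a polarisation of the symmetric form
    \<open>B\<close>.\<close>
  moreover have "B (b - a) (b - c) = B (b - a) (b - a) / 2 + B (b - c) (b - c) / 2 - B (a - c) (a - c) / 2"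
    unfolding B_left B_right using B_sym[of a b] B_sym[of a c] B_sym[of b c] by (simp add: field_simps)
  moreover have "pairing \<Omega> (F' a) (c - a) \<le> F c - F a"
    using F_diff abc by (intro convex_on_derivative_le[OF F_convex]) (auto simp: is_pre_derivative_def)
  then have "F b - F c \<le> pairing \<Omega> (F' a) (b - c) + L / 2 * B (b - a) (b - a)"
    using F_smooth unfolding Q pairing_diff[OF Fb] by linarith
  then have "\<tau> * (F b - F c) \<le> \<tau> * (pairing \<Omega> (F' a) (b - c) + L / 2 * B (b - a) (b - a))"
    using step by (intro mult_left_mono) auto
  \<comment> \<open>With \<open>\<tau> * L \<le> 1\<close>, half of \<open>B (b - a) (b - a)\<close>
    from the three-point identity absorbs the quadratic smoothness error.\<close>
  moreover have "\<tau> * L * B (b - a) (b - a) \<le> 1 * B (b - a) (b - a)"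
    using step(2) psd by (intro mult_right_mono) (auto simp: B_def)
  ultimately show "\<tau> * ((F b + \<alpha> * norm b) - (F c + \<alpha> * norm c)) \<le>
      pairing \<Omega> r (b - c) + (norm_conv \<Omega> \<rho> (a - c))\<^sup>2 / 2 - (norm_conv \<Omega> \<rho> (b - c))\<^sup>2 / 2"
    unfolding Q by (simp add: algebra_simps)
qed

text \<open>The excess of \<open>r\<close> over \<open>e\<close> is nonnegative and vanishes on the
  support of \<open>b\<close>, so it contributes nothing against \<open>b\<close> and enters with a
  negative sign against \<open>a\<close>. This links the amended condition, posed for the truncated
  residual, to \<open>FB_descent\<close>.\<close>

lemma pairing_le_truncated:
  fixes a b :: "'a::euclidean_space signed_measure"
  assumes \<Omega>: "\<Omega> \<in> sets borel" and r: "bdd_borel_on \<Omega> r"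
    and ab: "0 \<le> a" "0 \<le> b" and supp: "\<And>x. x \<in> supp b \<Longrightarrow> r x \<le> e"
  shows "pairing \<Omega> r (b - a) \<le> pairing \<Omega> (\<lambda>x. min e (r x)) (b - a)"
proof -
  have m: "bdd_borel_on \<Omega> (\<lambda>x. min e (r x))"
    by (rule bdd_borel_on_min[OF r \<Omega>])
  have eq: "r x - min e (r x) = r x + (-1) * min e (r x)" for x by simp
  have d: "bdd_borel_on \<Omega> (\<lambda>x. r x - min e (r x))"
    unfolding eq by (intro bdd_borel_on_add r bdd_borel_on_cmult m)
  have "pairing \<Omega> r (b - a) = pairing \<Omega> (\<lambda>x. min e (r x)) (b - a) + pairing \<Omega> (\<lambda>x. r x - min e (r x)) (b - a)"
    using pairing_add_fun[OF m d, of "b - a"] by simp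
  also have "pairing \<Omega> (\<lambda>x. r x - min e (r x)) (b - a) =
      pairing \<Omega> (\<lambda>x. r x - min e (r x)) b - pairing \<Omega> (\<lambda>x. r x - min e (r x)) a"
    by (rule pairing_diff[OF d])
  also have "pairing \<Omega> (\<lambda>x. r x - min e (r x)) b = 0"
    unfolding pairing_eq_sint using supp by (intro sint_nonneg_zero_on_supp ab) (simp add: min_absorb2)
  also have "0 - pairing \<Omega> (\<lambda>x. r x - min e (r x)) a \<le> 0"
    using pairing_mono[OF ab(1) bdd_borel_on_const[OF \<Omega>, of 0] d]
    by (simp add: pairing_eq_sint sint_def)
  finally show ?thesis by simp
qed

text \<open>The excess at \<open>Suc N\<close>, weighted by \<open>Suc N\<close>, is
  \<open>N\<close> times the excess at \<open>N\<close>, plus \<open>N\<close> times the increment,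
  plus one further excess. The weight \<open>N\<close> cancels the division by \<open>k\<close> in
  \<open>mono\<close>, leaving \<open>\<kappa> * e (Suc N)\<close>; with the \<open>\<kappa>\<close>
  from \<open>step\<close> this makes \<open>2 * \<kappa>\<close>.\<close>

lemma telescoped_rate:
  fixes j q e :: "nat \<Rightarrow> real"
  assumes step: "\<And>k. \<tau> * (j (Suc k) - jbar) \<le> e (Suc k) * (\<kappa> + m) + q k / 2 - q (Suc k) / 2"
    and mono: "\<And>k. k \<ge> 1 \<Longrightarrow> \<tau> * (j (Suc k) - j k) \<le> \<kappa> * e (Suc k) / real k"
    and pos: "0 \<le> \<kappa>" "\<And>k. 0 \<le> e (Suc k)"
  shows "real N * \<tau> * (j N - jbar) \<le> (2 * \<kappa> + m) * (\<Sum>k<N. e (Suc k)) + q 0 / 2 - q N / 2"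
proof (induction N)
  case (Suc N)
  have "real N * (\<tau> * (j (Suc N) - j N)) \<le> \<kappa> * e (Suc N)"
  proof (cases "N = 0")
    case False
    then show ?thesis
      using mono[of N] mult_left_mono[OF mono[of N], of "real N"] by simp
  qed (use pos in simp)
  then show ?case
    using step[of N] Suc.IH by (simp add: algebra_simps)
qed simp

theorem theorem4p13:
  fixes \<Omega> :: "'a::euclidean_space set"
    and \<rho> :: "'a \<Rightarrow> real" and \<rho>hat :: "'a \<Rightarrow> complex"
    and F :: "'a signed_measure \<Rightarrow> real" and F' :: "'a signed_measure \<Rightarrow> 'a \<Rightarrow> real"
    and \<alpha> L \<tau> \<kappa> :: real and \<epsilon> :: "nat \<Rightarrow> real"
    and \<mu> :: "nat \<Rightarrow> 'a signed_measure" and \<mu>bar :: "'a signed_measure"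
  assumes Omega: "compact \<Omega>"
    and alpha: "\<alpha> > 0"
    and rho_nonzero: "\<exists>x. \<rho> x \<noteq> 0"
    and rho_C0: "continuous_on UNIV \<rho>" "(\<rho> \<longlongrightarrow> 0) at_infinity"
    and rho_L2: "integrable lborel (\<lambda>x. (\<rho> x)\<^sup>2)"
    and rho_even: "\<And>y. \<rho> (- y) = \<rho> y"
    and rho_fourier: "L2_fourier_transform \<rho> \<rho>hat" "AE \<xi> in lborel. \<rho>hat \<xi> \<in> \<real>\<^sub>\<ge>\<^sub>0"
    and F_convex: "convex_on (measures_on \<Omega>) F"
    and F_diff: "is_pre_derivative \<Omega> F F'"
    and L_nonneg: "L \<ge> 0"
    and F_smooth: "\<And>\<nu> \<eta>. \<nu> \<in> measures_on \<Omega> \<Longrightarrow> \<eta> \<in> measures_on \<Omega> \<Longrightarrow>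
          F \<nu> - F \<eta> - pairing \<Omega> (F' \<eta>) (\<nu> - \<eta>) \<le> L / 2 * (norm_conv \<Omega> \<rho> (\<nu> - \<eta>))\<^sup>2"
    and step_length: "\<tau> > 0" "\<tau> * L \<le> 1"
    and mubar: "\<mu>bar \<in> measures_on \<Omega>" "(\<lambda>_. 0) \<in> pre_subdiff \<Omega> (objective F \<alpha>) \<mu>bar"
    and kappa: "0 < \<kappa>" "\<kappa> < 1"
    and eps_pos: "\<And>k. \<epsilon> (Suc k) > 0"
    and eps_mean: "(\<lambda>N. (1 / real N) * (\<Sum>k<N. \<epsilon> (Suc k))) \<longlonglongrightarrow> 0"
    and iterates: "mu_FB \<Omega> \<rho> F' \<alpha> \<tau> \<kappa> \<epsilon> \<mu>"
    and amended: "\<And>k. k \<ge> 1 \<Longrightarrow>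
          pairing \<Omega> (\<lambda>x. min (\<epsilon> (Suc k)) (FB_residual \<Omega> \<rho> F' \<alpha> \<tau> \<mu> k x)) (\<mu> (Suc k) - \<mu> k)
            \<le> \<kappa> * \<epsilon> (Suc k) / real k"
  shows "(\<lambda>N. objective F \<alpha> (\<mu> N)) \<longlonglongrightarrow> objective F \<alpha> \<mu>bar \<and>
    (\<forall>N \<ge> 1. objective F \<alpha> (\<mu> N) \<le> objective F \<alpha> \<mu>bar + ereal (1 / (real N * \<tau>) *
      ((2 * \<kappa> + norm \<mu>bar) * (\<Sum>k<N. \<epsilon> (Suc k)) + 1 / 2 * (norm_conv \<Omega> \<rho> (\<mu> 0 - \<mu>bar))\<^sup>2)))"
proof -
  have \<Omega>b: "\<Omega> \<in> sets borel" using Omega by (rule borel_compact)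
  \<comment> \<open>Decay at infinity bounds \<open>\<rho>\<close> outside a ball, compactness
    inside.\<close>
  obtain C where C: "\<And>x. \<bar>\<rho> x\<bar> \<le> C"
  proof -
    have "eventually (\<lambda>x. \<bar>\<rho> x\<bar> < 1) at_infinity"
      using tendstoD[OF rho_C0(2), of 1] by simp
    then obtain b where b: "\<And>x. b \<le> norm x \<Longrightarrow> \<bar>\<rho> x\<bar> < 1"
      by (auto simp: eventually_at_infinity)
    have "compact (\<rho> ` cball 0 b)"
      by (intro compact_continuous_image continuous_on_subset[OF rho_C0(1)]) auto
    then obtain D where D: "\<And>x. norm x \<le> b \<Longrightarrow> \<bar>\<rho> x\<bar> \<le> D"
      using compact_imp_bounded by (fastforce simp: bounded_iff)
    have "\<bar>\<rho> x\<bar> \<le> max 1 D" for x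
      using b[of x] D[of x] by (cases "norm x \<le> b") auto
    then show ?thesis by (rule that)
  qed
  note psd = conv_op_psd[OF \<Omega>b rho_C0(1) C rho_fourier]
  have sub: "\<mu> k \<in> measures_on \<Omega>" for k
    using iterates discrete_subset_measures_on unfolding mu_FB_def by (cases k) blast+
  \<comment> \<open>\<open>\<mu> 0\<close> may take negative values, so nonnegativity, and with it a
    finite objective, starts at index one.\<close>
  have nonneg: "0 \<le> \<mu> (Suc k)" for k
    using iterates by (simp add: mu_FB_def)
  define J where "J \<nu> = F \<nu> + \<alpha> * norm \<nu>" for \<nu>
  have obj: "objective F \<alpha> \<nu> = ereal (J \<nu>)" if "0 \<le> \<nu>" for \<nu>
    using that by (simp add: objective_def regulariser_def delta_nonneg_def J_def)
  have minimal: "objective F \<alpha> \<nu> - objective F \<alpha> \<mu>bar \<ge> 0" if "\<nu> \<in> measures_on \<Omega>" for \<nu>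
    using mubar(2) that by (simp add: pre_subdiff_def pairing_eq_sint sint_def zero_ereal_def)
  \<comment> \<open>Otherwise the objective at \<open>\<mu>bar\<close> would be infinite, while it
    is finite at the first iterate, and \<open>minimal\<close> would fail there.\<close>
  have bar_nonneg: "0 \<le> \<mu>bar"
  proof (rule ccontr)
    assume "\<not> 0 \<le> \<mu>bar"
    then have "objective F \<alpha> \<mu>bar = \<infinity>"
      by (simp add: objective_def regulariser_def delta_nonneg_def)
    then show False
      using minimal[OF sub[of 1]] obj[OF nonneg[of 0]] by simp
  qed
  have lower: "J \<mu>bar \<le> J (\<mu> (Suc k))" for k
    using minimal[OF sub[of "Suc k"]] by (simp add: obj nonneg bar_nonneg)
  let ?r = "FB_residual \<Omega> \<rho> F' \<alpha> \<tau> \<mu>"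
  have r: "?r k = (\<lambda>x. \<tau> * (F' (\<mu> k) x + \<alpha>) + conv_op \<Omega> \<rho> (\<mu> (Suc k) - \<mu> k) x)" for k
    by (simp add: FB_residual_def[abs_def])
  note descent = FB_descent[OF Omega rho_C0(1) C rho_even psd F_convex F_diff
      F_smooth[OF sub sub] step_length sub sub _ nonneg _ r, folded J_def]
  have rb: "bdd_borel_on \<Omega> (?r k)" for k
    by (rule descent(1)[OF mubar(1) bar_nonneg])
  define q where "q k = (norm_conv \<Omega> \<rho> (\<mu> k - \<mu>bar))\<^sup>2" for k
  \<comment> \<open>Comparison with \<open>\<mu>bar\<close>: the lower bound for the residual on all
    of \<open>\<Omega>\<close> costs \<open>\<epsilon> (Suc k) * norm \<mu>bar\<close>, the bound
    for its pairing with the new iterate costs \<open>\<kappa> * \<epsilon> (Suc k)\<close>.\<close>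
  have step: "\<tau> * (J (\<mu> (Suc k)) - J \<mu>bar) \<le> \<epsilon> (Suc k) * (\<kappa> + norm \<mu>bar) + q k / 2 - q (Suc k) / 2" for k
  proof -
    have "pairing \<Omega> (\<lambda>_. - \<epsilon> (Suc k)) \<mu>bar \<le> pairing \<Omega> (?r k) \<mu>bar"
      using iterates by (intro pairing_mono bar_nonneg rb bdd_borel_on_const \<Omega>b) (auto simp: mu_FB_def)
    moreover have "pairing \<Omega> (?r k) (\<mu> (Suc k)) \<le> \<kappa> * \<epsilon> (Suc k)"
      using iterates by (simp add: mu_FB_def)
    ultimately have "pairing \<Omega> (?r k) (\<mu> (Suc k) - \<mu>bar) \<le> \<epsilon> (Suc k) * (\<kappa> + norm \<mu>bar)"
      unfolding pairing_diff[OF rb] norm_eq_pairing[OF bar_nonneg mubar(1) \<Omega>b]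
      by (simp add: algebra_simps)
    then show ?thesis
      using descent(2)[OF mubar(1) bar_nonneg, of k] by (simp add: q_def)
  qed
  \<comment> \<open>Comparison with the current iterate, which is known to be nonnegative because
    \<open>k \<ge> 1\<close>.\<close>
  have mono: "\<tau> * (J (\<mu> (Suc k)) - J (\<mu> k)) \<le> \<kappa> * \<epsilon> (Suc k) / real k" if k: "k \<ge> 1" for k
  proof -
    have nk: "0 \<le> \<mu> k" using nonneg[of "k - 1"] k by simp
    have "norm_conv \<Omega> \<rho> (\<mu> k - \<mu> k) = 0"
    proof -
      have "pairing \<Omega> f 0 = 0" if "bdd_borel_on \<Omega> f" for f
        using pairing_diff[OF that, of 0 0] by simp
      moreover have "bdd_borel_on \<Omega> (conv_op \<Omega> \<rho> 0)"
        using borel_measurable_continuous_onI[OF rho_C0(1)]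
        by (intro bdd_borel_mult bdd_borel_indicator \<Omega>b bdd_borel_conv_op[OF _ _ C])
      ultimately show ?thesis by (simp add: norm_conv_def)
    qed
    then have "\<tau> * (J (\<mu> (Suc k)) - J (\<mu> k)) \<le>
        pairing \<Omega> (?r k) (\<mu> (Suc k) - \<mu> k) - (norm_conv \<Omega> \<rho> (\<mu> (Suc k) - \<mu> k))\<^sup>2 / 2"
      using descent(2)[OF sub[of k] nk, of k] by simp
    also have "\<dots> \<le> pairing \<Omega> (?r k) (\<mu> (Suc k) - \<mu> k)"
      by simp
    also have "\<dots> \<le> pairing \<Omega> (\<lambda>x. min (\<epsilon> (Suc k)) (?r k x)) (\<mu> (Suc k) - \<mu> k)"
      using iterates by (intro pairing_le_truncated \<Omega>b rb nk nonneg) (auto simp: mu_FB_def)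
    also have "\<dots> \<le> \<kappa> * \<epsilon> (Suc k) / real k"
      by (rule amended[OF k])
    finally show ?thesis .
  qed
  define R where "R N = 1 / (real N * \<tau>) *
      ((2 * \<kappa> + norm \<mu>bar) * (\<Sum>k<N. \<epsilon> (Suc k)) + 1 / 2 * (norm_conv \<Omega> \<rho> (\<mu> 0 - \<mu>bar))\<^sup>2)" for N
  have rate: "J (\<mu> (Suc n)) \<le> J \<mu>bar + R (Suc n)" for n
  proof -
    have "real (Suc n) * \<tau> * (J (\<mu> (Suc n)) - J \<mu>bar) \<le>
        (2 * \<kappa> + norm \<mu>bar) * (\<Sum>k<Suc n. \<epsilon> (Suc k)) + q 0 / 2 - q (Suc n) / 2"
      by (rule telescoped_rate[OF step mono]) (use kappa eps_pos in \<open>auto intro: less_imp_le\<close>)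
    also have "\<dots> \<le> (2 * \<kappa> + norm \<mu>bar) * (\<Sum>k<Suc n. \<epsilon> (Suc k)) + q 0 / 2"
      by (simp add: q_def)
    also have "\<dots> = real (Suc n) * \<tau> * R (Suc n)"
      using step_length by (simp add: R_def q_def)
    finally have "J (\<mu> (Suc n)) - J \<mu>bar \<le> R (Suc n)"
      using step_length by (subst (asm) mult_le_cancel_left_pos) auto
    then show ?thesis by simp
  qed
  \<comment> \<open>\<open>R\<close> is split into a multiple of the mean tolerance and a multiple
    of \<open>1 / N\<close>, so that the hypothesis on the means applies.\<close>
  have "(\<lambda>N. (2 * \<kappa> + norm \<mu>bar) / \<tau> * ((1 / real N) * (\<Sum>k<N. \<epsilon> (Suc k))) +
      q 0 / (2 * \<tau>) * (1 / real N)) \<longlonglongrightarrow> (2 * \<kappa> + norm \<mu>bar) / \<tau> * 0 + q 0 / (2 * \<tau>) * 0"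
    by (intro tendsto_intros eps_mean lim_1_over_n)
  moreover have "(\<lambda>N. (2 * \<kappa> + norm \<mu>bar) / \<tau> * ((1 / real N) * (\<Sum>k<N. \<epsilon> (Suc k))) +
      q 0 / (2 * \<tau>) * (1 / real N)) = R"
  proof -
    \<comment> \<open>The identity is used between functions of \<open>N\<close>, so it must also
      hold at \<open>N = 0\<close>, where division by zero makes both sides
      \<open>0\<close>.\<close>
    have "A / t * ((1 / n) * S) + Q / (2 * t) * (1 / n) = 1 / (n * t) * (A * S + 1 / 2 * Q)"
      for A t n S Q :: real
      by (cases "n = 0"; cases "t = 0") (auto simp: field_simps)
    then show ?thesis unfolding R_def q_def by (intro ext)
  qed
  ultimately have "R \<longlonglongrightarrow> 0"
    by simp
  then have "(\<lambda>n. J \<mu>bar + R (Suc n)) \<longlonglongrightarrow> J \<mu>bar + 0"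
    by (rule tendsto_add[OF tendsto_const LIMSEQ_Suc])
  then have upper: "(\<lambda>n. J \<mu>bar + R (Suc n)) \<longlonglongrightarrow> J \<mu>bar"
    by simp
  have "(\<lambda>n. J (\<mu> (Suc n))) \<longlonglongrightarrow> J \<mu>bar"
    by (rule tendsto_sandwich[OF _ _ tendsto_const upper]) (auto simp: lower rate)
  then have "(\<lambda>n. objective F \<alpha> (\<mu> (Suc n))) \<longlonglongrightarrow> objective F \<alpha> \<mu>bar"
    by (simp add: obj nonneg bar_nonneg)
  \<comment> \<open>A limit is not affected by the initial term, whose objective may be
    infinite.\<close>
  then have "(\<lambda>N. objective F \<alpha> (\<mu> N)) \<longlonglongrightarrow> objective F \<alpha> \<mu>bar"
    by (rule LIMSEQ_imp_Suc)
  moreover have "objective F \<alpha> (\<mu> N) \<le> objective F \<alpha> \<mu>bar + ereal (R N)" if "N \<ge> 1" for N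
    using that rate[of "N - 1"] nonneg[of "N - 1"] by (simp add: obj bar_nonneg)
  ultimately show ?thesis
    unfolding R_def by blast
qed

end
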